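(* Let $(\mathbb D,\|\cdot\|_{\mathbb D})$ and $(\mathbb E,\|\cdot\|_{\mathbb E})$ be normed spaces, and let $X_n:\Omega_1\to\chi_{1n}$, $M_n:\Omega_2\to\chi_{2n}$ ($n\in\mathbb N$) be sequences of functions (not assumed measurable), where $(\Omega_1\times\Omega_2,\mathcal A_1\otimes\mathcal A_2,Q_1\otimes Q_2)$ is a product probability space. Let $\phi:\mathbb D_\phi\subset\mathbb D\to\mathbb E$ be uniformly Hadamard differentiable at $P\in\mathbb D_\phi$ tangentially to a subspace $\mathbb D_0\subset\mathbb D$, with derivative $\phi'_P$. Let $(r_n)$ be a sequence of constants tending to infinity, let $(P_n)$ be a sequence in $\mathbb D_\phi$ with $P_n\to P$, and let $\mathbb P_n=\mathbb P_n(X_n):\Omega_1\to\mathbb D_\phi$ be maps with $$r_n(\mathbb P_n-P_n)\rightsquigarrow\mathbb G$$ for some separable Borel measurable random element $\mathbb G:\Omega_1\to\mathbb D_0$. Let $\widehat{\mathbb P}_n=\widehat{\mathbb P}_n(X_n,M_n):\Omega_1\times\Omega_2\to\mathbb D_\phi$ be maps with $$r_n(\widehat{\mathbb P}_n-\mathbb P_n)\rightsquigarrow\widehat{\mathbb G}$$ conditionally on $X_n$ in outer probability, for some separable Borel measurable random element $\widehat{\mathbb G}:\Omega_1\times\Omega_2\to\mathbb D_0$. Then $$r_n\bigl(\phi(\widehat{\mathbb P}_n)-\phi(\mathbb P_n)\bigr)\rightsquigarrow\phi'_P(\widehat{\mathbb G})$$ conditionally on $X_n$ in outer probability.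
   Context: Weak convergence: for arbitrary (possibly non-measurable) maps $Y_n$ from probability spaces into a metric space $\mathbb S$ and a Borel measurable random element $Y$ in $\mathbb S$, $Y_n\rightsquigarrow Y$ means $\mathrm E^*f(Y_n)\to\mathrm E f(Y)$ for every bounded continuous $f:\mathbb S\to\mathbb R$, where $\mathrm E^*$ is outer expectation. A random element is separable if it takes values in a separable subset with probability one. Uniform Hadamard differentiability: for metrizable topological vector spaces $\mathbb D,\mathbb E$, a map $\phi:\mathbb D_\phi\subset\mathbb D\to\mathbb E$ is uniformly Hadamard differentiable at $\theta\in\mathbb D_\phi$ tangentially to a subspace $\mathbb D_0\subset\mathbb D$ if there is a continuous linear map $\phi'_\theta:\mathbb D_0\to\mathbb E$ such that $t_n^{-1}(\phi(\theta_n+t_nh_n)-\phi(\theta_n))\to\phi'_\theta(h)$ for all real sequences $t_n\to0$ ($t_n\neq0$), all $h_n\to h\in\mathbb D_0$ in $\mathbb D$ and all $\theta_n\to\theta$ with $\theta_n,\theta_n+t_nh_n\in\mathbb D_\phi$ for all $n$. Conditional weak convergence in outer probability: for a metric space $\mathbb S$, let $BL_1(\mathbb S)$ be the set of functions $h:\mathbb S\to\mathbb R$ with $\|h\|_\infty\le1$ and Lipschitz constant at most $1$. For a real function $T$ on $\Omega_1\times\Omega_2$, $T^*$ and $T_*$ denote its minimal measurable majorant and maximal measurable minorant with respect to $(\Omega_1\times\Omega_2,\mathcal A_1\otimes\mathcal A_2,Q_1\otimes Q_2)$, and $T^{2*}$ denotes, for each fixed $\omega_1$, the minimal measurable majorant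 of $T(\omega_1,\cdot)$ with respect to $(\Omega_2,\mathcal A_2,Q_2)$. $\mathrm E_2$ denotes expectation over $(\Omega_2,\mathcal A_2,Q_2)$ with $\omega_1$ fixed (conditional expectation over $M_n$ given $X_n$). For maps $y_n=y_n(X_n,M_n):\Omega_1\times\Omega_2\to\mathbb S$ and a separable Borel measurable random element $Y$ in $\mathbb S$, "$y_n\rightsquigarrow Y$ conditionally on $X_n$ in outer probability" means that $$\sup_{h\in BL_1(\mathbb S)}\bigl|\mathrm E_2h(y_n)^{2*}-\mathrm Eh(Y)\bigr|\to0\quad\text{and}\quad \mathrm E_2h(y_n)^*-\mathrm E_2h(y_n)_*\to0\ \text{ for all }h\in BL_1(\mathbb S),$$ both in outer probability. *)

theory Defs
  imports "HOL-Probability.Probability"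
begin

text \<open>Uniform Hadamard differentiability at \<open>\<theta>\<close> tangentially to \<open>D0\<close>, with derivative \<open>\<phi>'\<close>.  Only the
  values of \<open>\<phi>\<close> on \<open>D\<phi>\<close> and of \<open>\<phi>'\<close> on \<open>D0\<close> matter; the sequence \<open>h\<close> need not stay in \<open>D0\<close>.\<close>

definition uniformly_hadamard_derivative ::
  "('d::real_normed_vector \<Rightarrow> 'e::real_normed_vector) \<Rightarrow> 'd set \<Rightarrow> 'd \<Rightarrow> 'd set \<Rightarrow> ('d \<Rightarrow> 'e) \<Rightarrow> bool"
  where
  "uniformly_hadamard_derivative \<phi> D\<phi> \<theta> D0 \<phi>' \<longleftrightarrow>
     \<theta> \<in> D\<phi> \<and> subspace D0 \<and>
     (\<forall>x\<in>D0. \<forall>y\<in>D0. \<phi>' (x + y) = \<phi>' x + \<phi>' y) \<and>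
     (\<forall>c. \<forall>x\<in>D0. \<phi>' (c *\<^sub>R x) = c *\<^sub>R \<phi>' x) \<and>
     continuous_on D0 \<phi>' \<and>
     (\<forall>(t :: nat \<Rightarrow> real) (h :: nat \<Rightarrow> 'd) (\<eta> :: nat \<Rightarrow> 'd) h0.
        t \<longlonglongrightarrow> 0 \<and> (\<forall>n. t n \<noteq> 0) \<and> h \<longlonglongrightarrow> h0 \<and> h0 \<in> D0 \<and> \<eta> \<longlonglongrightarrow> \<theta> \<and>
        (\<forall>n. \<eta> n \<in> D\<phi> \<and> \<eta> n + t n *\<^sub>R h n \<in> D\<phi>) \<longrightarrow>
        (\<lambda>n. inverse (t n) *\<^sub>R (\<phi> (\<eta> n + t n *\<^sub>R h n) - \<phi> (\<eta> n))) \<longlonglongrightarrow> \<phi>' h0)"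

definition separable_random_element :: "'a measure \<Rightarrow> ('a \<Rightarrow> 's::metric_space) \<Rightarrow> bool" where
  "separable_random_element N Y \<longleftrightarrow>
     Y \<in> borel_measurable N \<and> (\<exists>S. separable_space (top_of_set S) \<and> (AE \<omega> in N. Y \<omega> \<in> S))"

text \<open>Outer expectation.  It is only ever applied to bounded \<open>T\<close> on a probability space; there,
  real-valued integrable upper bounds give the same infimum as extended-real-valued measurable
  ones whose expectation exists.\<close>

definition outer_expectation :: "'a measure \<Rightarrow> ('a \<Rightarrow> real) \<Rightarrow> real" where
  "outer_expectation N T =
     Inf {integral\<^sup>L N U | U. integrable N U \<and> (\<forall>\<omega>\<in>space N. T \<omega> \<le> U \<omega>)}"

definition weakly_converges ::
  "(nat \<Rightarrow> 'a measure) \<Rightarrow> (nat \<Rightarrow> 'a \<Rightarrow> 's::metric_space) \<Rightarrow> 'b measure \<Rightarrow> ('b \<Rightarrow> 's) \<Rightarrow> bool" where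
  "weakly_converges N y N' Y \<longleftrightarrow>
     Y \<in> borel_measurable N' \<and>
     (\<forall>f :: 's \<Rightarrow> real. continuous_on UNIV f \<and> bounded (range f) \<longrightarrow>
        (\<lambda>n. outer_expectation (N n) (\<lambda>\<omega>. f (y n \<omega>))) \<longlonglongrightarrow> (\<integral>\<omega>. f (Y \<omega>) \<partial>N'))"

text \<open>Minimal measurable majorant and maximal measurable minorant.  They are unique only up to
  null sets, so a version is chosen; for bounded \<open>T\<close> on a probability space real-valued versions
  exist.\<close>

definition measurable_majorant :: "'a measure \<Rightarrow> ('a \<Rightarrow> real) \<Rightarrow> 'a \<Rightarrow> real" where
  "measurable_majorant N T = (SOME U. U \<in> borel_measurable N \<and> (\<forall>\<omega>\<in>space N. T \<omega> \<le> U \<omega>) \<and>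
     (\<forall>V\<in>borel_measurable N. (AE \<omega> in N. T \<omega> \<le> V \<omega>) \<longrightarrow> (AE \<omega> in N. U \<omega> \<le> V \<omega>)))"

definition measurable_minorant :: "'a measure \<Rightarrow> ('a \<Rightarrow> real) \<Rightarrow> 'a \<Rightarrow> real" where
  "measurable_minorant N T = (SOME U. U \<in> borel_measurable N \<and> (\<forall>\<omega>\<in>space N. U \<omega> \<le> T \<omega>) \<and>
     (\<forall>V\<in>borel_measurable N. (AE \<omega> in N. V \<omega> \<le> T \<omega>) \<longrightarrow> (AE \<omega> in N. V \<omega> \<le> U \<omega>)))"

definition BL1 :: "('s::metric_space \<Rightarrow> real) set" where
  "BL1 = {h. (\<forall>x. \<bar>h x\<bar> \<le> 1) \<and> 1-lipschitz_on UNIV h}"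

definition tendsto_0_outer_prob :: "'a measure \<Rightarrow> (nat \<Rightarrow> 'a \<Rightarrow> real) \<Rightarrow> bool" where
  "tendsto_0_outer_prob N Z \<longleftrightarrow>
     (\<forall>\<epsilon>>0. (\<lambda>n. outer_measure_of N {\<omega> \<in> space N. \<bar>Z n \<omega>\<bar> > \<epsilon>}) \<longlonglongrightarrow> 0)"

text \<open>Conditional weak convergence in outer probability of maps \<open>y n\<close> on the product of \<open>Q1\<close> and
  \<open>Q2\<close>, conditionally on the first coordinate.  In the first condition the majorant is taken over \<open>Q2\<close>
  for fixed \<open>\<omega>1\<close>, in the second one jointly over the product space.  All functions under the
  supremum are bounded by 2, so the supremum of reals is a genuine one.\<close>

definition cond_weakly_converges ::
  "'a measure \<Rightarrow> 'b measure \<Rightarrow> (nat \<Rightarrow> 'a \<times> 'b \<Rightarrow> 's::metric_space) \<Rightarrow> 'c measure \<Rightarrow> ('c \<Rightarrow> 's) \<Rightarrow> bool"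
  where
  "cond_weakly_converges Q1 Q2 y N Y \<longleftrightarrow>
     separable_random_element N Y \<and>
     tendsto_0_outer_prob Q1
       (\<lambda>n \<omega>1. SUP h\<in>BL1.
          \<bar>(\<integral>\<omega>2. measurable_majorant Q2 (\<lambda>\<omega>. h (y n (\<omega>1, \<omega>))) \<omega>2 \<partial>Q2) - (\<integral>\<omega>. h (Y \<omega>) \<partial>N)\<bar>) \<and>
     (\<forall>h\<in>BL1. tendsto_0_outer_prob Q1
       (\<lambda>n \<omega>1.
          (\<integral>\<omega>2. measurable_majorant (Q1 \<Otimes>\<^sub>M Q2) (\<lambda>\<omega>. h (y n \<omega>)) (\<omega>1, \<omega>2) \<partial>Q2) -
          (\<integral>\<omega>2. measurable_minorant (Q1 \<Otimes>\<^sub>M Q2) (\<lambda>\<omega>. h (y n \<omega>)) (\<omega>1, \<omega>2) \<partial>Q2)))"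

end

theory Submission
  imports Defs
begin

text \<open>
  Write \<open>y\<^sub>n = r\<^sub>n (Phat\<^sub>n - Pemp\<^sub>n)\<close> and let \<open>z\<^sub>n\<close> be the rescaled difference of the \<open>\<phi>\<close>-values, a difference
  quotient of \<open>\<phi>\<close> at \<open>Pemp\<^sub>n\<close> with step \<open>1 / r\<^sub>n\<close> in direction \<open>y\<^sub>n\<close>.  By separability, finitely many balls
  around points of \<open>D0\<close> carry all but \<open>\<epsilon>\<close> of the law of \<open>Ghat\<close>, and their radii can be so small that by
  uniform Hadamard differentiability \<open>z\<^sub>n\<close> is close to \<open>\<phi>'\<close> of the centre whenever \<open>y\<^sub>n\<close> lies in such a
  ball and \<open>Pemp\<^sub>n\<close> is near \<open>P\<close>.  As \<open>\<phi>'\<close> is \<open>K\<close>-Lipschitz on \<open>D0\<close>, each \<open>h \<circ> \<phi>'\<close> with \<open>h \<in> BL1\<close>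
  extends from \<open>D0\<close> to \<open>K g\<close> with \<open>g \<in> BL1\<close>.  Hence \<open>\<bar>h z\<^sub>n - K g y\<^sub>n\<bar> \<le> \<epsilon> + c q y\<^sub>n\<close>, where the
  Lipschitz function \<open>q\<close> cuts off the balls and \<open>c E q Ghat \<le> \<epsilon>\<close>, and \<open>K\<close>, \<open>c\<close>, \<open>q\<close> do not depend
  on \<open>h\<close>.  Both conditions for \<open>z\<^sub>n\<close> then follow from those for \<open>y\<^sub>n\<close>.
\<close>

section \<open>Measurable majorants and outer probability\<close>

text \<open>This is the predicate under the choice in \<open>measurable_majorant\<close>. Giving it
  a name lets minorants be handled as negatives of majorants of the negated function.\<close>

definition is_majorant :: "'a measure \<Rightarrow> ('a \<Rightarrow> real) \<Rightarrow> ('a \<Rightarrow> real) \<Rightarrow> bool" where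
  "is_majorant N T U \<longleftrightarrow> U \<in> borel_measurable N \<and> (\<forall>\<omega>\<in>space N. T \<omega> \<le> U \<omega>) \<and>
     (\<forall>V\<in>borel_measurable N. (AE \<omega> in N. T \<omega> \<le> V \<omega>) \<longrightarrow> (AE \<omega> in N. U \<omega> \<le> V \<omega>))"

lemma is_majorant_le:
  assumes "is_majorant N T U" "AE \<omega> in N. T \<omega> \<le> V \<omega>" "V \<in> borel_measurable N"
  shows "AE \<omega> in N. U \<omega> \<le> V \<omega>"
  using assms by (simp add: is_majorant_def)

text \<open>Take integrable upper bounds \<open>W i\<close> whose integrals approach the infimum
  \<open>I\<close> over all of them. Their pointwise infimum \<open>U\<close> is again an upper
  bound and attains \<open>I\<close>, and this optimality forces minimality: cutting
  \<open>U\<close> down by another bound \<open>V\<close> cannot lower the integral.\<close>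

lemma (in prob_space) is_majorant_exists:
  fixes T :: "'a \<Rightarrow> real"
  assumes bnd: "\<And>\<omega>. \<omega> \<in> space M \<Longrightarrow> \<bar>T \<omega>\<bar> \<le> C"
  shows "\<exists>U. is_majorant M T U"
proof -
  define F where "F = {U. integrable M U \<and> (\<forall>\<omega>\<in>space M. T \<omega> \<le> U \<omega>)}"
  define I where "I = Inf (integral\<^sup>L M ` F)"
  have FC: "(\<lambda>_. C) \<in> F"
    using bnd by (auto simp: F_def abs_le_iff)
  have lower: "- C \<le> integral\<^sup>L M U" if "U \<in> F" for U
  proof -
    have "(\<integral>\<omega>. - C \<partial>M) \<le> integral\<^sup>L M U"
    proof (rule integral_mono)
      show "integrable M U" using that by (simp add: F_def)
      fix \<omega> assume "\<omega> \<in> space M"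
      then have "- C \<le> T \<omega>" "T \<omega> \<le> U \<omega>" using bnd[of \<omega>] that by (auto simp: F_def)
      then show "- C \<le> U \<omega>" by simp
    qed auto
    then show ?thesis by (simp add: prob_space)
  qed
  have bdd: "bdd_below (integral\<^sup>L M ` F)"
    using lower by (intro bdd_belowI2[of _ "- C"]) auto
  have "\<exists>U\<in>F. integral\<^sup>L M U < I + 1 / real (Suc i)" for i
  proof -
    have "Inf (integral\<^sup>L M ` F) < I + 1 / real (Suc i)" by (simp add: I_def)
    then show ?thesis using cInf_lessD[of "integral\<^sup>L M ` F"] FC by blast
  qed
  then obtain W where W: "\<And>i. W i \<in> F" "\<And>i. integral\<^sup>L M (W i) < I + 1 / real (Suc i)"
    by metis
  define U where "U \<omega> = (INF i. W i \<omega>)" for \<omega>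
  have bddW: "bdd_below (range (\<lambda>i. W i \<omega>))" if "\<omega> \<in> space M" for \<omega>
    using that W(1) by (intro bdd_belowI2[of _ "T \<omega>"]) (auto simp: F_def)
  have UW: "U \<omega> \<le> W i \<omega>" if "\<omega> \<in> space M" for \<omega> i
    unfolding U_def by (rule cINF_lower[OF bddW[OF that]]) simp
  have TU: "T \<omega> \<le> U \<omega>" if "\<omega> \<in> space M" for \<omega>
    unfolding U_def using that W(1) by (intro cINF_greatest) (auto simp: F_def)
  have measW[measurable]: "W i \<in> borel_measurable M" for i
    using W(1) by (auto simp: F_def)
  have measU[measurable]: "U \<in> borel_measurable M"
    unfolding U_def by (rule borel_measurable_cINF) (auto intro: bddW)
  \<comment> \<open>A measurable function between \<open>T\<close> and \<open>W 0\<close> is caught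
    between \<open>- C\<close> and an integrable function. This serves for \<open>U\<close> and for
    the modified bound \<open>V'\<close> below.\<close>
  have dom: "integrable M V" if "V \<in> borel_measurable M" "\<And>\<omega>. \<omega> \<in> space M \<Longrightarrow> T \<omega> \<le> V \<omega>"
    "\<And>\<omega>. \<omega> \<in> space M \<Longrightarrow> V \<omega> \<le> W 0 \<omega>" for V
  proof (rule Bochner_Integration.integrable_bound)
    show "integrable M (\<lambda>\<omega>. C + \<bar>W 0 \<omega>\<bar>)" using W(1)[of 0] by (auto simp: F_def)
    show "AE \<omega> in M. norm (V \<omega>) \<le> norm (C + \<bar>W 0 \<omega>\<bar>)"
    proof (rule AE_I2)
      fix \<omega> assume "\<omega> \<in> space M"
      then have "- C \<le> V \<omega>" "V \<omega> \<le> W 0 \<omega>" "0 \<le> C" using bnd[of \<omega>] that(2,3)[of \<omega>] by auto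
      then show "norm (V \<omega>) \<le> norm (C + \<bar>W 0 \<omega>\<bar>)" by auto
    qed
  qed fact
  have intU: "integrable M U" by (rule dom) (auto intro: TU UW)
  have "integral\<^sup>L M U \<le> I"
  proof (rule field_le_epsilon)
    fix e :: real assume "e > 0"
    then obtain i where "1 / real (Suc i) < e" using nat_approx_posE by blast
    moreover have "integral\<^sup>L M U \<le> integral\<^sup>L M (W i)"
      using intU W(1)[of i] UW by (intro integral_mono) (auto simp: F_def)
    ultimately show "integral\<^sup>L M U \<le> I + e" using W(2)[of i] by linarith
  qed
  moreover have IF: "I \<le> integral\<^sup>L M V" if "V \<in> F" for V
    unfolding I_def using bdd that by (intro cINF_lower) auto
  ultimately have UI: "integral\<^sup>L M U \<le> integral\<^sup>L M V" if "V \<in> F" for V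
    using that by (meson order_trans)
  have "AE \<omega> in M. U \<omega> \<le> V \<omega>" if [measurable]: "V \<in> borel_measurable M" and TV: "AE \<omega> in M. T \<omega> \<le> V \<omega>" for V
  proof -
    obtain N where N: "N \<in> null_sets M" "{\<omega>\<in>space M. \<not> T \<omega> \<le> V \<omega>} \<subseteq> N"
      using TV unfolding eventually_ae_filter by auto
    have [measurable]: "N \<in> sets M" using N by auto
    \<comment> \<open>\<open>V\<close> dominates \<open>T\<close> only outside the null set
      \<open>N\<close>, so \<open>U\<close> is kept on \<open>N\<close>. Then \<open>V'\<close> is
      an upper bound at every point and competes for the infimum \<open>I\<close>.\<close>
    define V' where "V' \<omega> = (if \<omega> \<in> N then U \<omega> else min (U \<omega>) (V \<omega>))" for \<omega>
    have meas: "V' \<in> borel_measurable M" unfolding V'_def by measurable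
    have TV': "T \<omega> \<le> V' \<omega>" if "\<omega> \<in> space M" for \<omega>
      using TU[OF that] N(2) that by (auto simp: V'_def)
    have V'U: "V' \<omega> \<le> U \<omega>" for \<omega> by (auto simp: V'_def)
    have intV': "integrable M V'"
      using meas TV' order_trans[OF V'U UW] by (rule dom)
    have "integral\<^sup>L M U \<le> integral\<^sup>L M V'"
      by (rule UI) (use intV' TV' in \<open>auto simp: F_def\<close>)
    moreover have "integral\<^sup>L M V' \<le> integral\<^sup>L M U"
      by (rule integral_mono) (use intV' intU V'U in auto)
    ultimately have "(\<integral>\<omega>. U \<omega> - V' \<omega> \<partial>M) = 0" using intU intV' by simp
    then have "AE \<omega> in M. U \<omega> - V' \<omega> = 0"
      using intU intV' V'U by (subst (asm) integral_nonneg_eq_0_iff_AE) auto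
    moreover have "AE \<omega> in M. \<omega> \<notin> N" by (rule AE_not_in[OF N(1)])
    ultimately show ?thesis by eventually_elim (auto simp: V'_def min_def split: if_splits)
  qed
  with TU show ?thesis unfolding is_majorant_def by (intro exI[of _ U]) auto
qed

lemma (in prob_space) is_majorant_measurable_majorant:
  fixes T :: "'a \<Rightarrow> real"
  assumes bnd: "\<And>\<omega>. \<omega> \<in> space M \<Longrightarrow> \<bar>T \<omega>\<bar> \<le> C"
  shows "is_majorant M T (measurable_majorant M T)"
  using someI_ex[OF is_majorant_exists[of T C]] bnd
  unfolding measurable_majorant_def is_majorant_def by blast

text \<open>Negation exchanges upper and lower bounds as well as minimality and maximality, so the
  minorant chosen for \<open>T\<close> is the negative of a majorant of \<open>- T\<close>. Facts
  about majorants then cover both notions.\<close>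

lemma (in prob_space) is_majorant_measurable_minorant:
  fixes T :: "'a \<Rightarrow> real"
  assumes bnd: "\<And>\<omega>. \<omega> \<in> space M \<Longrightarrow> \<bar>T \<omega>\<bar> \<le> C"
  shows "is_majorant M (\<lambda>\<omega>. - T \<omega>) (\<lambda>\<omega>. - measurable_minorant M T \<omega>)"
proof -
  \<comment> \<open>The equivalence is proved for every \<open>U\<close> so that it can rewrite the
    predicate inside the choice operator into the one of \<open>measurable_minorant\<close>.\<close>
  have minorant: "is_majorant M (\<lambda>\<omega>. - T \<omega>) (\<lambda>\<omega>. - U \<omega>) \<longleftrightarrow>
     U \<in> borel_measurable M \<and> (\<forall>\<omega>\<in>space M. U \<omega> \<le> T \<omega>) \<and>
     (\<forall>V\<in>borel_measurable M. (AE \<omega> in M. V \<omega> \<le> T \<omega>) \<longrightarrow> (AE \<omega> in M. V \<omega> \<le> U \<omega>))" for U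
  proof -
    have "(\<forall>V\<in>borel_measurable M. (AE \<omega> in M. - T \<omega> \<le> V \<omega>) \<longrightarrow> (AE \<omega> in M. - U \<omega> \<le> V \<omega>)) \<longleftrightarrow>
      (\<forall>V\<in>borel_measurable M. (AE \<omega> in M. V \<omega> \<le> T \<omega>) \<longrightarrow> (AE \<omega> in M. V \<omega> \<le> U \<omega>))"
      (is "(\<forall>V\<in>_. ?P V) \<longleftrightarrow> (\<forall>V\<in>_. ?Q V)")
    proof (intro iffI ballI)
      fix V :: "'a \<Rightarrow> real" assume *: "\<forall>V\<in>borel_measurable M. ?P V" "V \<in> borel_measurable M"
      then have "?P (\<lambda>\<omega>. - V \<omega>)" by (intro bspec[OF *(1)]) measurable
      then show "?Q V" by simp
    next
      fix V :: "'a \<Rightarrow> real" assume *: "\<forall>V\<in>borel_measurable M. ?Q V" "V \<in> borel_measurable M"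
      then have "?Q (\<lambda>\<omega>. - V \<omega>)" by (intro bspec[OF *(1)]) measurable
      then show "?P V" by (simp add: minus_le_iff)
    qed
    moreover have "(\<lambda>\<omega>. - U \<omega>) \<in> borel_measurable M \<longleftrightarrow> U \<in> borel_measurable M"
      by simp
    ultimately show ?thesis unfolding is_majorant_def by simp
  qed
  obtain U where "is_majorant M (\<lambda>\<omega>. - T \<omega>) U"
    using is_majorant_exists[of "\<lambda>\<omega>. - T \<omega>" C] bnd by auto
  then have "is_majorant M (\<lambda>\<omega>. - T \<omega>) (\<lambda>\<omega>. - (- U \<omega>))" by simp
  then have "is_majorant M (\<lambda>\<omega>. - T \<omega>)
      (\<lambda>\<omega>. - (SOME U. is_majorant M (\<lambda>\<omega>. - T \<omega>) (\<lambda>\<omega>. - U \<omega>)) \<omega>)"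
    by (rule someI[where P = "\<lambda>U. is_majorant M (\<lambda>\<omega>. - T \<omega>) (\<lambda>\<omega>. - U \<omega>)"])
  then show ?thesis
    unfolding minorant measurable_minorant_def by simp
qed

text \<open>The constant \<open>C\<close> is a competing upper bound, so minimality gives
  \<open>U \<le> C\<close> almost everywhere, while \<open>T\<close> keeps \<open>U\<close> above
  \<open>- C\<close>.\<close>

lemma (in prob_space) integrable_is_majorant:
  fixes T :: "'a \<Rightarrow> real"
  assumes U: "is_majorant M T U" and bnd: "\<And>\<omega>. \<omega> \<in> space M \<Longrightarrow> \<bar>T \<omega>\<bar> \<le> C"
  shows "integrable M U"
proof (rule integrable_const_bound)
  show "U \<in> borel_measurable M" using U by (simp add: is_majorant_def)
  have "AE \<omega> in M. T \<omega> \<le> C" using bnd by (intro AE_I2) (auto simp: abs_le_iff)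
  then have "AE \<omega> in M. U \<omega> \<le> C" using U by (auto simp: is_majorant_def)
  moreover have "AE \<omega> in M. - C \<le> U \<omega>"
  proof (rule AE_I2)
    fix \<omega> assume "\<omega> \<in> space M"
    then have "- C \<le> T \<omega>" "T \<omega> \<le> U \<omega>" using bnd[of \<omega>] U by (auto simp: is_majorant_def)
    then show "- C \<le> U \<omega>" by simp
  qed
  ultimately show "AE \<omega> in M. norm (U \<omega>) \<le> C" by eventually_elim auto
qed

lemma (in prob_space) integral_majorant_le:
  fixes T V :: "'a \<Rightarrow> real"
  assumes bnd: "\<And>\<omega>. \<omega> \<in> space M \<Longrightarrow> \<bar>T \<omega>\<bar> \<le> C"
    and V: "integrable M V" "\<And>\<omega>. \<omega> \<in> space M \<Longrightarrow> T \<omega> \<le> V \<omega>"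
  shows "integral\<^sup>L M (measurable_majorant M T) \<le> integral\<^sup>L M V"
proof -
  have maj: "is_majorant M T (measurable_majorant M T)"
    by (rule is_majorant_measurable_majorant) (rule bnd)
  have "AE \<omega> in M. T \<omega> \<le> V \<omega>" using V(2) by auto
  then have "AE \<omega> in M. measurable_majorant M T \<omega> \<le> V \<omega>"
    using maj V(1) by (auto simp: is_majorant_def)
  with integrable_is_majorant[OF maj bnd] V(1) show ?thesis
    by (intro integral_mono_AE) auto
qed

lemma (in prob_space) integral_le_majorant:
  fixes T V :: "'a \<Rightarrow> real"
  assumes bnd: "\<And>\<omega>. \<omega> \<in> space M \<Longrightarrow> \<bar>T \<omega>\<bar> \<le> C"
    and V: "integrable M V" "\<And>\<omega>. \<omega> \<in> space M \<Longrightarrow> V \<omega> \<le> T \<omega>"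
  shows "integral\<^sup>L M V \<le> integral\<^sup>L M (measurable_majorant M T)"
proof -
  have maj: "is_majorant M T (measurable_majorant M T)"
    by (rule is_majorant_measurable_majorant) (rule bnd)
  have "V \<omega> \<le> measurable_majorant M T \<omega>" if "\<omega> \<in> space M" for \<omega>
    using V(2)[OF that] maj that unfolding is_majorant_def by fastforce
  with integrable_is_majorant[OF maj bnd] V(1) show ?thesis
    by (intro integral_mono) auto
qed

lemma (in prob_space) abs_integral_majorant_le:
  fixes T :: "'a \<Rightarrow> real"
  assumes bnd: "\<And>\<omega>. \<omega> \<in> space M \<Longrightarrow> \<bar>T \<omega>\<bar> \<le> C"
  shows "\<bar>integral\<^sup>L M (measurable_majorant M T)\<bar> \<le> C"
proof -
  have "integral\<^sup>L M (measurable_majorant M T) \<le> (\<integral>\<omega>. C \<partial>M)"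
    by (rule integral_majorant_le[OF bnd]) (use bnd in \<open>auto simp: abs_le_iff\<close>)
  moreover have "(\<integral>\<omega>. - C \<partial>M) \<le> integral\<^sup>L M (measurable_majorant M T)"
    by (rule integral_le_majorant[OF bnd]) (use bnd in \<open>auto simp: abs_le_iff minus_le_iff\<close>)
  ultimately show ?thesis by (simp add: prob_space)
qed

text \<open>This is subadditivity of outer expectation. The same combination of the majorants of
  \<open>T1\<close> and \<open>T2\<close> is measurable and, the coefficients being nonnegative,
  still dominates \<open>T\<close>.\<close>

lemma (in prob_space) integral_majorant_combination:
  fixes T T1 T2 :: "'a \<Rightarrow> real"
  assumes bnd: "\<And>\<omega>. \<omega> \<in> space M \<Longrightarrow> \<bar>T \<omega>\<bar> \<le> C"
    and bnd1: "\<And>\<omega>. \<omega> \<in> space M \<Longrightarrow> \<bar>T1 \<omega>\<bar> \<le> C1"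
    and bnd2: "\<And>\<omega>. \<omega> \<in> space M \<Longrightarrow> \<bar>T2 \<omega>\<bar> \<le> C2"
    and le: "\<And>\<omega>. \<omega> \<in> space M \<Longrightarrow> T \<omega> \<le> a + b1 * T1 \<omega> + b2 * T2 \<omega>"
    and "b1 \<ge> 0" "b2 \<ge> 0"
  shows "integral\<^sup>L M (measurable_majorant M T) \<le>
    a + b1 * integral\<^sup>L M (measurable_majorant M T1) + b2 * integral\<^sup>L M (measurable_majorant M T2)"
proof -
  let ?U1 = "measurable_majorant M T1" and ?U2 = "measurable_majorant M T2"
  have maj1: "is_majorant M T1 ?U1"
    by (rule is_majorant_measurable_majorant) (rule bnd1)
  have maj2: "is_majorant M T2 ?U2"
    by (rule is_majorant_measurable_majorant) (rule bnd2)
  have [simp]: "integrable M ?U1" "integrable M ?U2"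
    using integrable_is_majorant[OF maj1 bnd1] integrable_is_majorant[OF maj2 bnd2] by auto
  have "integral\<^sup>L M (measurable_majorant M T) \<le> (\<integral>\<omega>. a + b1 * ?U1 \<omega> + b2 * ?U2 \<omega> \<partial>M)"
  proof (rule integral_majorant_le[OF bnd])
    fix \<omega> assume "\<omega> \<in> space M"
    then have "T1 \<omega> \<le> ?U1 \<omega>" "T2 \<omega> \<le> ?U2 \<omega>"
      using maj1 maj2 by (auto simp: is_majorant_def)
    then have "b1 * T1 \<omega> \<le> b1 * ?U1 \<omega>" "b2 * T2 \<omega> \<le> b2 * ?U2 \<omega>"
      using assms(5,6) by (auto intro: mult_left_mono)
    then show "T \<omega> \<le> a + b1 * ?U1 \<omega> + b2 * ?U2 \<omega>"
      using le[OF \<open>\<omega> \<in> space M\<close>] by linarith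
  qed auto
  then show ?thesis by (simp add: prob_space)
qed

section \<open>Outer probability and sequences of asymptotically negligible sets\<close>

lemma outer_measure_of_Un_le:
  assumes "A \<subseteq> space M" "B \<subseteq> space M"
  shows "outer_measure_of M (A \<union> B) \<le> outer_measure_of M A + outer_measure_of M B"
proof -
  obtain A' B' where *: "A' \<in> sets M" "A \<subseteq> A'" "outer_measure_of M A = emeasure M A'"
    "B' \<in> sets M" "B \<subseteq> B'" "outer_measure_of M B = emeasure M B'"
    using outer_measure_of_attain[OF assms(1)] outer_measure_of_attain[OF assms(2)] by auto
  then have "outer_measure_of M (A \<union> B) \<le> emeasure M (A' \<union> B')"
    using outer_measure_of_mono[of "A \<union> B" "A' \<union> B'" M] by auto
  also have "\<dots> \<le> emeasure M A' + emeasure M B'"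
    using * by (intro emeasure_subadditive) auto
  finally show ?thesis using * by simp
qed

text \<open>Such sequences collect the exceptional events of the asymptotic arguments. Inclusion in
  the space is recorded because measurable covers attaining the outer measure are taken of subsets
  of the space.\<close>

definition outer_null :: "'a measure \<Rightarrow> (nat \<Rightarrow> 'a set) \<Rightarrow> bool" where
  "outer_null N A \<longleftrightarrow> (\<forall>n. A n \<subseteq> space N) \<and> (\<lambda>n. outer_measure_of N (A n)) \<longlonglongrightarrow> 0"

lemma outer_null_Un:
  assumes "outer_null N A" "outer_null N B"
  shows "outer_null N (\<lambda>n. A n \<union> B n)"
proof -
  have "(\<lambda>n. outer_measure_of N (A n \<union> B n)) \<longlonglongrightarrow> 0"
  proof (rule tendsto_sandwich[of "\<lambda>_. 0"])
    show "(\<lambda>n. outer_measure_of N (A n) + outer_measure_of N (B n)) \<longlonglongrightarrow> 0"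
      using tendsto_add[of _ "0::ennreal" _ _ 0] assms by (fastforce simp: outer_null_def)
    show "\<forall>\<^sub>F n in sequentially. outer_measure_of N (A n \<union> B n) \<le>
        outer_measure_of N (A n) + outer_measure_of N (B n)"
      using assms by (intro always_eventually allI outer_measure_of_Un_le) (auto simp: outer_null_def)
  qed auto
  then show ?thesis using assms by (auto simp: outer_null_def)
qed

lemma outer_null_measurable_cover:
  assumes "outer_null N A"
  obtains B where "\<And>n. B n \<in> sets N" "\<And>n. A n \<subseteq> B n" "outer_null N B"
proof -
  have "\<forall>n. \<exists>B\<in>sets N. A n \<subseteq> B \<and> outer_measure_of N (A n) = emeasure N B"
    using assms by (auto simp: outer_null_def intro: outer_measure_of_attain)
  then obtain B where "\<forall>n. B n \<in> sets N \<and> A n \<subseteq> B n \<and> outer_measure_of N (A n) = emeasure N (B n)"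
    by metis
  with assms show thesis by (intro that[of B]) (auto simp: outer_null_def dest: sets.sets_into_space)
qed

lemma tendsto_0_outer_prob_iff:
  "tendsto_0_outer_prob N Z \<longleftrightarrow> (\<forall>\<epsilon>>0. outer_null N (\<lambda>n. {\<omega> \<in> space N. \<bar>Z n \<omega>\<bar> > \<epsilon>}))"
  by (auto simp: tendsto_0_outer_prob_def outer_null_def)

text \<open>The bound is asked for only almost everywhere off \<open>A n\<close>, because statements
  about sections of joint majorants hold only for almost every first coordinate. The extra null set
  does not change the outer measure.\<close>

lemma tendsto_0_outer_probI:
  assumes "\<And>\<epsilon>. \<epsilon> > 0 \<Longrightarrow> \<exists>A. outer_null N A \<and>
    (\<forall>\<^sub>F n in sequentially. AE \<omega> in N. \<omega> \<notin> A n \<longrightarrow> \<bar>Z n \<omega>\<bar> \<le> \<epsilon>)"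
  shows "tendsto_0_outer_prob N Z"
  unfolding tendsto_0_outer_prob_def
proof (intro allI impI)
  fix \<epsilon> :: real assume "\<epsilon> > 0"
  then obtain A where A: "outer_null N A"
    and ev: "\<forall>\<^sub>F n in sequentially. AE \<omega> in N. \<omega> \<notin> A n \<longrightarrow> \<bar>Z n \<omega>\<bar> \<le> \<epsilon>"
    using assms by blast
  show "(\<lambda>n. outer_measure_of N {\<omega> \<in> space N. \<bar>Z n \<omega>\<bar> > \<epsilon>}) \<longlonglongrightarrow> 0"
  proof (rule tendsto_sandwich[of "\<lambda>_. 0"])
    show "(\<lambda>n. outer_measure_of N (A n)) \<longlonglongrightarrow> 0" using A by (simp add: outer_null_def)
    show "\<forall>\<^sub>F n in sequentially.
        outer_measure_of N {\<omega> \<in> space N. \<bar>Z n \<omega>\<bar> > \<epsilon>} \<le> outer_measure_of N (A n)"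
      using ev
    proof eventually_elim
      case (elim n)
      then obtain E where E: "E \<in> null_sets N" "{\<omega>\<in>space N. \<not> (\<omega> \<notin> A n \<longrightarrow> \<bar>Z n \<omega>\<bar> \<le> \<epsilon>)} \<subseteq> E"
        unfolding eventually_ae_filter by auto
      then have "outer_measure_of N {\<omega> \<in> space N. \<bar>Z n \<omega>\<bar> > \<epsilon>} \<le> outer_measure_of N (A n \<union> E)"
        by (intro outer_measure_of_mono) force
      also have "\<dots> \<le> outer_measure_of N (A n) + outer_measure_of N E"
        using A E(1) by (intro outer_measure_of_Un_le) (auto simp: outer_null_def dest: sets.sets_into_space)
      also have "outer_measure_of N E = 0" using E(1) by (simp add: null_sets_def)
      finally show ?case by simp
    qed
  qed auto
qed

text \<open>Markov's inequality for outer expectation: it holds for each integrable upper bound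
  \<open>U\<close> of \<open>f\<close>, and the infimum over \<open>U\<close> preserves it.\<close>

lemma (in prob_space) outer_measure_le_outer_expectation:
  assumes "\<And>\<omega>. \<omega> \<in> space M \<Longrightarrow> 0 \<le> f \<omega>" "\<And>\<omega>. \<omega> \<in> space M \<Longrightarrow> f \<omega> \<le> C"
  shows "outer_measure_of M {\<omega> \<in> space M. 1 \<le> f \<omega>} \<le> ennreal (outer_expectation M f)"
proof -
  let ?A = "{\<omega> \<in> space M. 1 \<le> f \<omega>}"
  have bound: "outer_measure_of M ?A \<le> ennreal (integral\<^sup>L M U)"
    if U: "integrable M U" "\<forall>\<omega>\<in>space M. f \<omega> \<le> U \<omega>" for U
  proof -
    have [measurable]: "U \<in> borel_measurable M" using U(1) by simp
    have "outer_measure_of M ?A \<le> outer_measure_of M {\<omega> \<in> space M. 1 \<le> U \<omega>}"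
      using U by (intro outer_measure_of_mono) force
    also have "\<dots> = emeasure M {\<omega> \<in> space M. 1 \<le> U \<omega>}"
      by (intro outer_measure_of_eq) measurable
    also have "\<dots> = ennreal (prob {\<omega> \<in> space M. 1 \<le> U \<omega>})"
      by (rule emeasure_eq_measure)
    also have "\<dots> \<le> ennreal (integral\<^sup>L M U)"
    proof (rule ennreal_leI)
      have "AE \<omega> in M. 0 \<le> U \<omega>" using U assms(1) by (intro AE_I2) force
      then show "prob {\<omega> \<in> space M. 1 \<le> U \<omega>} \<le> integral\<^sup>L M U"
        using integral_Markov_inequality_measure[OF U(1), of "{}" 1] by auto
    qed
    finally show ?thesis .
  qed
  \<comment> \<open>Finiteness moves the comparison to the reals, where the infimum defining
    \<open>outer_expectation\<close> is taken. The constant \<open>C\<close> provides the finite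
    bound here and the nonemptiness of the set of integrals below.\<close>
  have "outer_measure_of M ?A \<noteq> \<top>"
    using bound[of "\<lambda>_. C"] assms(2) by (auto simp: top_unique)
  then have eq: "outer_measure_of M ?A = ennreal (enn2real (outer_measure_of M ?A))"
    by (simp add: less_top)
  have "enn2real (outer_measure_of M ?A) \<le> outer_expectation M f"
    unfolding outer_expectation_def
  proof (rule cInf_greatest)
    show "{integral\<^sup>L M U |U. integrable M U \<and> (\<forall>\<omega>\<in>space M. f \<omega> \<le> U \<omega>)} \<noteq> {}"
      using assms(2) by (auto intro!: exI[of _ "\<lambda>_. C"])
    fix x assume "x \<in> {integral\<^sup>L M U |U. integrable M U \<and> (\<forall>\<omega>\<in>space M. f \<omega> \<le> U \<omega>)}"
    then obtain U where U: "x = integral\<^sup>L M U" "integrable M U" "\<forall>\<omega>\<in>space M. f \<omega> \<le> U \<omega>" by auto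
    have "0 \<le> U \<omega>" if "\<omega> \<in> space M" for \<omega>
      using U(3) assms(1)[OF that] that by fastforce
    then have "0 \<le> x" unfolding U by (intro integral_nonneg_AE AE_I2)
    then show "enn2real (outer_measure_of M ?A) \<le> x"
      using enn2real_mono[OF bound[OF U(2,3)]] U(1) by simp
  qed
  then show ?thesis by (subst eq) (rule ennreal_leI)
qed

text \<open>Weak convergence to a random element makes the norms bounded in outer probability, so
  they rarely reach a threshold that tends to infinity. For rescaled differences this yields
  consistency of the unscaled ones.\<close>

lemma weakly_converges_scaled_null:
  fixes y :: "nat \<Rightarrow> 'a \<Rightarrow> 'd::real_normed_vector"
  assumes "prob_space N" and wc: "weakly_converges (\<lambda>_. N) y N Y"
    and r: "filterlim r at_top sequentially" and "\<delta> > 0"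
  shows "outer_null N (\<lambda>n. {\<omega> \<in> space N. r n * \<delta> \<le> norm (y n \<omega>)})"
proof -
  interpret prob_space N by fact
  let ?A = "\<lambda>n. {\<omega> \<in> space N. r n * \<delta> \<le> norm (y n \<omega>)}"
  \<comment> \<open>A continuous ramp in the norm: it is 0 up to level \<open>C\<close> and 1 from
    level \<open>C + 1\<close> on, so it is an admissible test function dominating the indicator of
    the larger norms.\<close>
  define f where "f C x = min 1 (max 0 (norm x - C))" for C :: real and x :: 'd
  have f01: "0 \<le> f C x" "f C x \<le> 1" for C x by (auto simp: f_def)
  have cont: "continuous_on UNIV (f C)" for C
    unfolding f_def by (intro continuous_intros)
  have [measurable]: "Y \<in> borel_measurable N" using wc by (simp add: weakly_converges_def)
  have [measurable]: "(\<lambda>\<omega>. f C (Y \<omega>)) \<in> borel_measurable N" for C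
    using borel_measurable_continuous_onI[OF cont] by measurable
  have "(\<lambda>m. \<integral>\<omega>. f (real m) (Y \<omega>) \<partial>N) \<longlonglongrightarrow> (\<integral>\<omega>. 0 \<partial>N)"
  proof (rule integral_dominated_convergence[where w = "\<lambda>_. 1"])
    show "AE \<omega> in N. (\<lambda>m. f (real m) (Y \<omega>)) \<longlonglongrightarrow> 0"
    proof (rule AE_I2)
      fix \<omega>
      obtain m0 where "norm (Y \<omega>) \<le> real m0" using real_arch_simple by blast
      then have "f (real m) (Y \<omega>) = 0" if "m \<ge> m0" for m using that by (auto simp: f_def)
      then show "(\<lambda>m. f (real m) (Y \<omega>)) \<longlonglongrightarrow> 0"
        by (intro tendsto_eventually) (auto simp: eventually_sequentially)
    qed
  qed (use f01 in auto)
  then have lim0: "(\<lambda>m. \<integral>\<omega>. f (real m) (Y \<omega>) \<partial>N) \<longlonglongrightarrow> 0" by simp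
  have "(\<lambda>n. outer_measure_of N (?A n)) \<longlonglongrightarrow> 0"
  proof (rule order_tendstoI)
    fix a :: ennreal assume "0 < a"
    then obtain b where b: "0 < b" "b < a" using dense by blast
    define e where "e = enn2real b"
    have "b \<noteq> \<top>" using b(2) by (auto simp: top_unique)
    then have e: "0 < e" "ennreal e < a"
      using b by (auto simp: e_def enn2real_positive_iff less_top)
    \<comment> \<open>The level \<open>m\<close> is fixed through the limit \<open>Y\<close> alone;
      only then is \<open>n\<close> taken large, so that both the expectation is close to its limit
      and \<open>r n * \<delta>\<close> exceeds \<open>m + 1\<close>.\<close>
    obtain m where m: "(\<integral>\<omega>. f (real m) (Y \<omega>) \<partial>N) < e"
      using order_tendstoD(2)[OF lim0 e(1)] by (auto simp: eventually_sequentially)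
    have "bounded (range (f (real m)))"
      using f01 by (auto simp: bounded_iff intro!: exI[of _ 1])
    then have "(\<lambda>n. outer_expectation N (\<lambda>\<omega>. f (real m) (y n \<omega>))) \<longlonglongrightarrow> (\<integral>\<omega>. f (real m) (Y \<omega>) \<partial>N)"
      using wc cont unfolding weakly_converges_def by blast
    from order_tendstoD(2)[OF this m]
    have "\<forall>\<^sub>F n in sequentially. outer_expectation N (\<lambda>\<omega>. f (real m) (y n \<omega>)) < e" .
    moreover have "\<forall>\<^sub>F n in sequentially. (real m + 1) / \<delta> \<le> r n"
      using r by (simp add: filterlim_at_top)
    ultimately show "\<forall>\<^sub>F n in sequentially. outer_measure_of N (?A n) < a"
    proof eventually_elim
      case (elim n)
      have "real m + 1 \<le> r n * \<delta>" using elim(2) \<open>\<delta> > 0\<close> by (simp add: field_simps)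
      then have "outer_measure_of N (?A n) \<le> outer_measure_of N {\<omega> \<in> space N. 1 \<le> f (real m) (y n \<omega>)}"
        by (intro outer_measure_of_mono) (auto simp: f_def)
      also have "\<dots> \<le> ennreal (outer_expectation N (\<lambda>\<omega>. f (real m) (y n \<omega>)))"
        by (rule outer_measure_le_outer_expectation) (use f01 in auto)
      also have "\<dots> \<le> ennreal e" using elim(1) by (intro ennreal_leI) simp
      also have "\<dots> < a" by fact
      finally show ?case .
    qed
  qed auto
  then show ?thesis by (auto simp: outer_null_def)
qed

section \<open>Uniform Hadamard derivatives and Lipschitz extension\<close>

text \<open>If no radius worked, violations at radii \<open>1 / (n + 1)\<close> would form sequences
  to which the sequential definition applies, and their difference quotients would have to converge.
  The radius governs step, base point and direction at once.\<close>

lemma uniformly_hadamard_eps_delta: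
  assumes uhd: "uniformly_hadamard_derivative \<phi> D\<phi> \<theta>0 D0 \<phi>'" and "h0 \<in> D0" "\<epsilon> > 0"
  obtains \<delta> where "\<delta> > 0"
    "\<And>t \<theta> h. \<lbrakk>t \<noteq> 0; \<bar>t\<bar> < \<delta>; dist \<theta> \<theta>0 < \<delta>; dist h h0 < \<delta>; \<theta> \<in> D\<phi>; \<theta> + t *\<^sub>R h \<in> D\<phi>\<rbrakk> \<Longrightarrow>
      dist (inverse t *\<^sub>R (\<phi> (\<theta> + t *\<^sub>R h) - \<phi> \<theta>)) (\<phi>' h0) < \<epsilon>"
proof -
  have "\<exists>\<delta>>0. \<forall>t \<theta> h. t \<noteq> 0 \<and> \<bar>t\<bar> < \<delta> \<and> dist \<theta> \<theta>0 < \<delta> \<and> dist h h0 < \<delta> \<and> \<theta> \<in> D\<phi> \<and> \<theta> + t *\<^sub>R h \<in> D\<phi> \<longrightarrow>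
      dist (inverse t *\<^sub>R (\<phi> (\<theta> + t *\<^sub>R h) - \<phi> \<theta>)) (\<phi>' h0) < \<epsilon>"
  proof (rule ccontr)
    assume neg: "\<not> ?thesis"
    have "\<exists>t \<theta> h. t \<noteq> 0 \<and> \<bar>t\<bar> < inverse (real (Suc n)) \<and> dist \<theta> \<theta>0 < inverse (real (Suc n)) \<and>
        dist h h0 < inverse (real (Suc n)) \<and> \<theta> \<in> D\<phi> \<and> \<theta> + t *\<^sub>R h \<in> D\<phi> \<and>
        \<not> dist (inverse t *\<^sub>R (\<phi> (\<theta> + t *\<^sub>R h) - \<phi> \<theta>)) (\<phi>' h0) < \<epsilon>" for n
    proof -
      have "inverse (real (Suc n)) > 0" by simp
      with neg show ?thesis by blast
    qed
    then obtain t \<theta> h where *: "\<And>n. t n \<noteq> 0" "\<And>n. \<bar>t n\<bar> < inverse (real (Suc n))"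
      "\<And>n. dist (\<theta> n) \<theta>0 < inverse (real (Suc n))" "\<And>n. dist (h n) h0 < inverse (real (Suc n))"
      "\<And>n. \<theta> n \<in> D\<phi>" "\<And>n. \<theta> n + t n *\<^sub>R h n \<in> D\<phi>"
      "\<And>n. \<not> dist (inverse (t n) *\<^sub>R (\<phi> (\<theta> n + t n *\<^sub>R h n) - \<phi> (\<theta> n))) (\<phi>' h0) < \<epsilon>"
      by metis
    have lim: "g \<longlonglongrightarrow> l" if "\<And>n. dist (g n) l < inverse (real (Suc n))" for g :: "nat \<Rightarrow> 'z::metric_space" and l
    proof -
      have "(\<lambda>n. dist (g n) l) \<longlonglongrightarrow> 0"
        by (rule tendsto_sandwich[OF _ _ tendsto_const LIMSEQ_inverse_real_of_nat])
          (use that in \<open>auto intro!: always_eventually less_imp_le\<close>)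
      then show ?thesis by (rule tendsto_dist_iff[THEN iffD2])
    qed
    have "t \<longlonglongrightarrow> 0" by (rule lim) (use *(2) in simp)
    moreover have "\<theta> \<longlonglongrightarrow> \<theta>0" "h \<longlonglongrightarrow> h0" using *(3,4) by (auto intro: lim)
    ultimately have "(\<lambda>n. inverse (t n) *\<^sub>R (\<phi> (\<theta> n + t n *\<^sub>R h n) - \<phi> (\<theta> n))) \<longlonglongrightarrow> \<phi>' h0"
      using uhd *(1,5,6) \<open>h0 \<in> D0\<close> unfolding uniformly_hadamard_derivative_def by blast
    from tendstoD[OF this \<open>\<epsilon> > 0\<close>] show False
      using *(7) by (auto simp: eventually_sequentially)
  qed
  then show thesis using that by blast
qed

text \<open>Continuity at 0 bounds \<open>f\<close> on a small ball of \<open>D\<close>, scaling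
  turns this into an operator bound, and additivity into a Lipschitz bound. The constant is raised
  to at least 1 so that later division by it keeps functions bounded by 1.\<close>

lemma linear_on_subspace_imp_lipschitz:
  fixes f :: "'d::real_normed_vector \<Rightarrow> 'e::real_normed_vector"
  assumes D: "subspace D" and add: "\<And>x y. x \<in> D \<Longrightarrow> y \<in> D \<Longrightarrow> f (x + y) = f x + f y"
    and scale: "\<And>c x. x \<in> D \<Longrightarrow> f (c *\<^sub>R x) = c *\<^sub>R f x" and cont: "continuous_on D f"
  obtains K where "K \<ge> 1" "K-lipschitz_on D f"
proof -
  have D0: "0 \<in> D" using D by (rule subspace_0)
  have f0: "f 0 = 0" using scale[OF D0, of 0] by simp
  obtain d where d: "d > 0" "\<And>x. x \<in> D \<Longrightarrow> dist x 0 < d \<Longrightarrow> dist (f x) (f 0) < 1"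
    using cont D0 unfolding continuous_on_iff by (metis zero_less_one)
  have bound: "norm (f x) \<le> 2 / d * norm x" if "x \<in> D" for x
  proof (cases "x = 0")
    case False
    \<comment> \<open>This factor scales \<open>x\<close> to norm \<open>d / 2\<close>, inside the
      ball where \<open>f\<close> has norm below 1.\<close>
    define c where "c = d / (2 * norm x)"
    have c: "c > 0" using False d(1) by (simp add: c_def)
    have "c *\<^sub>R x \<in> D" using D that by (rule subspace_scale)
    moreover have "dist (c *\<^sub>R x) 0 < d" using False d(1) by (simp add: c_def)
    ultimately have "norm (c *\<^sub>R f x) < 1" using d(2)[of "c *\<^sub>R x"] scale[OF that] f0 by simp
    then have "c * norm (f x) < 1" using c by simp
    then have "norm (f x) < 1 / c" using c by (simp add: field_simps)
    then show ?thesis by (simp add: c_def)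
  qed (simp add: f0)
  have "(max 1 (2 / d))-lipschitz_on D f"
  proof (rule lipschitz_onI)
    fix x y assume xy: "x \<in> D" "y \<in> D"
    have "x - y \<in> D" using D xy by (rule subspace_diff)
    moreover have "f x = f (x - y) + f y" using add[OF \<open>x - y \<in> D\<close> xy(2)] by simp
    ultimately have "dist (f x) (f y) \<le> 2 / d * norm (x - y)"
      using bound[of "x - y"] by (simp add: dist_norm)
    also have "\<dots> \<le> max 1 (2 / d) * norm (x - y)" by (intro mult_right_mono) auto
    finally show "dist (f x) (f y) \<le> max 1 (2 / d) * dist x y" by (simp add: dist_norm)
  qed simp
  then show thesis by (intro that[of "max 1 (2 / d)"]) auto
qed

lemma lipschitz_extension_bounded:
  fixes f :: "'d::metric_space \<Rightarrow> real"
  assumes lip: "K-lipschitz_on S f" and bnd: "\<And>x. x \<in> S \<Longrightarrow> \<bar>f x\<bar> \<le> B" and "S \<noteq> {}"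
  obtains g where "K-lipschitz_on UNIV g" "\<And>x. \<bar>g x\<bar> \<le> B" "\<And>x. x \<in> S \<Longrightarrow> g x = f x"
proof -
  have K: "K \<ge> 0" using lip by (rule lipschitz_on_nonneg)
  \<comment> \<open>McShane's formula; truncation to \<open>[- B, B]\<close> restores the bound.\<close>
  define m where "m x = (INF y\<in>S. f y + K * dist x y)" for x
  have bdd: "bdd_below ((\<lambda>y. f y + K * dist x y) ` S)" for x
  proof (rule bdd_belowI2)
    fix y assume "y \<in> S"
    then show "- B \<le> f y + K * dist x y" using bnd[of y] K mult_nonneg_nonneg[OF K zero_le_dist[of x y]] by linarith
  qed
  \<comment> \<open>The triangle inequality compares the two infima term by term; exchanging
    \<open>x\<close> and \<open>y\<close> gives the Lipschitz bound.\<close>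
  have m_le: "m x \<le> m y + K * dist x y" for x y
  proof -
    have "m x - K * dist x y \<le> m y"
      unfolding m_def[of y]
    proof (rule cINF_greatest)
      fix z assume "z \<in> S"
      then have "m x \<le> f z + K * dist x z" unfolding m_def by (intro cINF_lower bdd)
      moreover have "K * dist x z \<le> K * (dist x y + dist y z)"
        using K by (intro mult_left_mono dist_triangle)
      ultimately show "m x - K * dist x y \<le> f z + K * dist y z" by (simp add: distrib_left)
    qed fact
    then show ?thesis by simp
  qed
  have m_eq: "m x = f x" if "x \<in> S" for x
  proof (rule antisym)
    have "m x \<le> f x + K * dist x x" unfolding m_def by (rule cINF_lower[OF bdd that])
    then show "m x \<le> f x" by simp
    show "f x \<le> m x"
      unfolding m_def
    proof (rule cINF_greatest)
      fix y assume "y \<in> S"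
      then show "f x \<le> f y + K * dist x y"
        using lipschitz_onD[OF lip that, of y] by (simp add: dist_real_def)
    qed fact
  qed
  have "B \<ge> 0" using bnd \<open>S \<noteq> {}\<close> by force
  show thesis
  proof (rule that)
    show "K-lipschitz_on UNIV (\<lambda>x. max (- B) (min B (m x)))"
    proof (rule lipschitz_onI)
      fix x y
      show "dist (max (- B) (min B (m x))) (max (- B) (min B (m y))) \<le> K * dist x y"
        using m_le[of x y] m_le[of y x] K
        by (simp add: dist_real_def dist_commute max_def min_def abs_if)
    qed fact
    show "\<bar>max (- B) (min B (m x))\<bar> \<le> B" for x using \<open>B \<ge> 0\<close> by auto
    show "max (- B) (min B (m x)) = f x" if "x \<in> S" for x
      using bnd[OF that] m_eq[OF that] by auto
  qed
qed

section \<open>Finite covers and Lipschitz approximation\<close>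

text \<open>Balls of rational radius around a countable dense set form a base. Second countability
  is the useful form because it passes to arbitrary subspaces, here to intersections with
  \<open>D0\<close>.\<close>

lemma separable_imp_second_countable:
  fixes S :: "'d::metric_space set"
  assumes "separable_space (top_of_set S)"
  shows "second_countable (top_of_set S)"
proof -
  obtain C where C: "countable C" "C \<subseteq> S" "top_of_set S closure_of C = S"
    using assms by (auto simp: separable_space_def)
  define B where "B = (\<lambda>(c, q). S \<inter> ball c q) ` (C \<times> \<rat>)"
  have "countable B" using C(1) by (auto simp: B_def countable_rat)
  moreover have "\<forall>V\<in>B. openin (top_of_set S) V" by (auto simp: B_def openin_open_Int)
  moreover have "\<forall>U x. openin (top_of_set S) U \<and> x \<in> U \<longrightarrow> (\<exists>V\<in>B. x \<in> V \<and> V \<subseteq> U)"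
  proof (intro allI impI)
    fix U x assume U: "openin (top_of_set S) U \<and> x \<in> U"
    then obtain e where e: "e > 0" "ball x e \<inter> S \<subseteq> U" "x \<in> S"
      unfolding openin_contains_ball by blast
    have "x \<in> top_of_set S closure_of C" using C(3) e(3) by simp
    then have "\<exists>c\<in>C. c \<in> S \<inter> ball x (e / 3)"
      using e by (auto simp: in_closure_of dest!: spec[of _ "S \<inter> ball x (e / 3)"] openin_open_Int[of "ball x (e / 3)" S])
    then obtain c where c: "c \<in> C" "dist x c < e / 3" by auto
    \<comment> \<open>A radius above \<open>e / 3\<close> makes the ball around \<open>c\<close>
      contain \<open>x\<close>; a radius below \<open>e / 2\<close> keeps it within
      \<open>e / 3 + e / 2 < e\<close> of \<open>x\<close>.\<close>
    obtain q where q: "q \<in> \<rat>" "e / 3 < q" "q < e / 2" using Rats_dense_in_real[of "e / 3" "e / 2"] e(1) by auto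
    have "S \<inter> ball c q \<in> B" using c q by (auto simp: B_def)
    moreover have "x \<in> S \<inter> ball c q" using e c q by (auto simp: dist_commute)
    moreover have "S \<inter> ball c q \<subseteq> U"
    proof
      fix z assume z: "z \<in> S \<inter> ball c q"
      have "dist x z \<le> dist x c + dist c z" by (rule dist_triangle)
      then have "dist x z < e" using z c q e(1) by simp
      then show "z \<in> U" using e(2) z by auto
    qed
    ultimately show "\<exists>V\<in>B. x \<in> V \<and> V \<subseteq> U" by blast
  qed
  ultimately show ?thesis unfolding second_countable_def by blast
qed

text \<open>The Lindelof property of \<open>S \<inter> D0\<close> extracts a countable subcover from
  the balls around all points of \<open>D0\<close>. Continuity of the measure from above then
  reduces it to a finite one, up to mass \<open>\<eta>\<close>.\<close>

lemma separable_random_element_finite_cover: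
  fixes Y :: "'a \<Rightarrow> 'd::metric_space"
  assumes "prob_space N" and sep: "separable_random_element N Y"
    and D0: "\<And>\<omega>. \<omega> \<in> space N \<Longrightarrow> Y \<omega> \<in> D0" and \<delta>: "\<And>x. x \<in> D0 \<Longrightarrow> \<delta> x > 0" and "\<eta> > 0"
  obtains F where "finite F" "F \<noteq> {}" "F \<subseteq> D0"
    "measure N {\<omega> \<in> space N. Y \<omega> \<notin> (\<Union>x\<in>F. ball x (\<delta> x))} < \<eta>"
proof -
  interpret prob_space N by fact
  obtain S where Y[measurable]: "Y \<in> borel_measurable N"
    and S: "separable_space (top_of_set S)" "AE \<omega> in N. Y \<omega> \<in> S"
    using sep by (auto simp: separable_random_element_def)
  have "second_countable (top_of_set (S \<inter> D0))"
    using second_countable_subtopology[OF separable_imp_second_countable[OF S(1)], of D0]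
    by (simp add: subtopology_subtopology)
  then have "Lindelof_space (top_of_set (S \<inter> D0))" by (rule second_countable_imp_Lindelof_space)
  then have Lindelof: "\<And>\<U>. (\<forall>U\<in>\<U>. openin (top_of_set (S \<inter> D0)) U) \<and> S \<inter> D0 \<subseteq> \<Union>\<U> \<Longrightarrow>
      \<exists>\<V>. countable \<V> \<and> \<V> \<subseteq> \<U> \<and> S \<inter> D0 \<subseteq> \<Union>\<V>"
    unfolding Lindelof_space_alt by simp
  have "\<forall>U\<in>(\<lambda>x. S \<inter> D0 \<inter> ball x (\<delta> x)) ` D0. openin (top_of_set (S \<inter> D0)) U"
    by (auto simp: openin_open_Int)
  moreover have "S \<inter> D0 \<subseteq> \<Union> ((\<lambda>x. S \<inter> D0 \<inter> ball x (\<delta> x)) ` D0)"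
    using \<delta> by auto
  ultimately obtain V where V: "countable V" "V \<subseteq> (\<lambda>x. S \<inter> D0 \<inter> ball x (\<delta> x)) ` D0" "S \<inter> D0 \<subseteq> \<Union>V"
    using Lindelof[of "(\<lambda>x. S \<inter> D0 \<inter> ball x (\<delta> x)) ` D0"] by blast
  obtain E where E: "countable E" "E \<subseteq> D0" "V = (\<lambda>x. S \<inter> D0 \<inter> ball x (\<delta> x)) ` E"
    using countable_subset_image[of V] V(1,2) by metis
  obtain \<omega>0 where "\<omega>0 \<in> space N" using not_empty by auto
  \<comment> \<open>Adding a value of \<open>Y\<close> makes the set of centres nonempty, so that it
    can be enumerated by the sequence \<open>e\<close>.\<close>
  define E' where "E' = insert (Y \<omega>0) E"
  have E': "countable E'" "E' \<noteq> {}" "E' \<subseteq> D0" using E D0[OF \<open>\<omega>0 \<in> space N\<close>] by (auto simp: E'_def)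
  have cover: "S \<inter> D0 \<subseteq> (\<Union>x\<in>E'. ball x (\<delta> x))" using V(3) E(3) by (auto simp: E'_def)
  define e where "e = from_nat_into E'"
  have range_e: "range e = E'" using E' by (simp add: e_def)
  define A where "A n = {\<omega> \<in> space N. Y \<omega> \<notin> (\<Union>i\<le>n. ball (e i) (\<delta> (e i)))}" for n :: nat
  have A[measurable]: "A n \<in> sets N" for n
  proof -
    have "- (\<Union>i\<le>n. ball (e i) (\<delta> (e i))) \<in> sets borel" by (intro borel_comp borel_open open_UN) auto
    then have "Y -` (- (\<Union>i\<le>n. ball (e i) (\<delta> (e i)))) \<inter> space N \<in> sets N" by (rule measurable_sets[OF Y])
    moreover have "A n = Y -` (- (\<Union>i\<le>n. ball (e i) (\<delta> (e i)))) \<inter> space N" by (auto simp: A_def)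
    ultimately show ?thesis by simp
  qed
  have dec: "decseq A" by (auto simp: A_def decseq_def)
  have "AE \<omega> in N. \<omega> \<notin> (\<Inter>n. A n)"
    using S(2) AE_space
  proof eventually_elim
    case (elim \<omega>)
    then obtain i where "Y \<omega> \<in> ball (e i) (\<delta> (e i))" using cover D0 range_e by blast
    then have "\<omega> \<notin> A i" by (auto simp: A_def)
    then show ?case by auto
  qed
  then have "measure N (\<Inter>n. A n) = 0"
    by (subst (asm) AE_iff_null_sets[symmetric]) (auto simp: measure_def null_sets_def)
  moreover have "(\<lambda>n. measure N (A n)) \<longlonglongrightarrow> measure N (\<Inter>n. A n)"
    by (rule finite_Lim_measure_decseq) (use dec in auto)
  ultimately obtain n where n: "measure N (A n) < \<eta>"
    using order_tendstoD(2)[of _ 0 sequentially \<eta>] \<open>\<eta> > 0\<close> by (auto simp: eventually_sequentially)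
  show thesis
    by (rule that[of "e ` {..n}"]) (use n E' range_e in \<open>auto simp: A_def\<close>)
qed

section \<open>Bounded Lipschitz functions of a separable random element\<close>

lemma BL1_measurable:
  assumes "h \<in> BL1" "Y \<in> borel_measurable N"
  shows "(\<lambda>\<omega>. h (Y \<omega>)) \<in> borel_measurable N"
proof -
  have "continuous_on UNIV h" using assms(1) by (auto simp: BL1_def intro: lipschitz_on_continuous_on)
  from measurable_compose[OF assms(2) borel_measurable_continuous_onI[OF this]] show ?thesis .
qed

lemma (in prob_space) BL1_integrable:
  assumes "h \<in> BL1" "Y \<in> borel_measurable M"
  shows "integrable M (\<lambda>\<omega>. h (Y \<omega>))"
  by (rule integrable_const_bound[of _ 1]) (use assms BL1_measurable in \<open>auto simp: BL1_def\<close>)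

lemma (in prob_space) BL1_expectation_bound:
  assumes "h \<in> BL1" "Y \<in> borel_measurable M"
  shows "\<bar>\<integral>\<omega>. h (Y \<omega>) \<partial>M\<bar> \<le> 1"
proof -
  have "\<bar>\<integral>\<omega>. h (Y \<omega>) \<partial>M\<bar> \<le> (\<integral>\<omega>. \<bar>h (Y \<omega>)\<bar> \<partial>M)" by (rule integral_abs_bound)
  also have "\<dots> \<le> (\<integral>\<omega>. 1 \<partial>M)"
    using BL1_integrable[OF assms] assms(1) by (intro integral_mono) (auto simp: BL1_def)
  finally show ?thesis by (simp add: prob_space)
qed

text \<open>Halved radii are used to carry the mass, which leaves room for a Lipschitz ramp up to
  the full balls. The function \<open>c * q\<close> lies between the indicators of the complements
  of the full and of the halved balls, so its expectation is at most \<open>\<eta>\<close>.\<close>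

lemma separable_random_element_BL1_cutoff:
  fixes Y :: "'a \<Rightarrow> 'd::metric_space"
  assumes "prob_space N" and sep: "separable_random_element N Y"
    and D0: "\<And>\<omega>. \<omega> \<in> space N \<Longrightarrow> Y \<omega> \<in> D0" and \<delta>: "\<And>x. x \<in> D0 \<Longrightarrow> \<delta> x > 0" and "\<eta> > 0"
  obtains F q c where "finite F" "F \<noteq> {}" "F \<subseteq> D0" "q \<in> BL1" "c > 0" "\<And>y. 0 \<le> q y"
    "\<And>y. y \<notin> (\<Union>x\<in>F. ball x (\<delta> x)) \<Longrightarrow> 1 \<le> c * q y"
    "c * (\<integral>\<omega>. q (Y \<omega>) \<partial>N) \<le> \<eta>"
proof -
  interpret prob_space N by fact
  have Y[measurable]: "Y \<in> borel_measurable N" using sep by (simp add: separable_random_element_def)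
  have \<delta>2: "\<delta> x / 2 > 0" if "x \<in> D0" for x using \<delta>[OF that] by simp
  obtain F where F: "finite F" "F \<noteq> {}" "F \<subseteq> D0"
    "measure N {\<omega> \<in> space N. Y \<omega> \<notin> (\<Union>x\<in>F. ball x (\<delta> x / 2))} < \<eta>"
    by (rule separable_random_element_finite_cover[OF assms(1) sep D0 \<delta>2 \<open>\<eta> > 0\<close>])
  define U where "U = (\<Union>x\<in>F. ball x (\<delta> x / 2))"
  \<comment> \<open>Being at most every halved radius, \<open>\<rho>\<close> bounds from below the
    distance to \<open>U\<close> of points outside the full balls; being at most 1, it keeps the
    truncated distance \<open>q\<close> in \<open>BL1\<close>.\<close>
  define \<rho> where "\<rho> = min 1 (Min ((\<lambda>x. \<delta> x / 2) ` F))"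
  have \<rho>: "0 < \<rho>" "\<rho> \<le> 1" using F(1-3) \<delta> by (auto simp: \<rho>_def)
  have \<rho>_le: "\<rho> \<le> \<delta> x / 2" if "x \<in> F" for x
  proof -
    have "Min ((\<lambda>x. \<delta> x / 2) ` F) \<le> \<delta> x / 2" using F(1) that by (intro Min_le) auto
    then show ?thesis by (simp add: \<rho>_def)
  qed
  have "U \<noteq> {}" using F(2,3) \<delta> by (force simp: U_def)
  define q where "q y = min \<rho> (infdist y U)" for y
  have q01: "0 \<le> q y" "q y \<le> \<rho>" for y using \<rho> by (auto simp: q_def infdist_nonneg)
  have "\<bar>q x - q y\<bar> \<le> dist x y" for x y
    using infdist_triangle_abs[of x U y] by (auto simp: q_def)
  then have q: "q \<in> BL1"
    using q01 \<rho> order_trans[OF q01(2) \<rho>(2)] by (auto simp: BL1_def dist_real_def intro!: lipschitz_onI)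
  have out: "1 \<le> 1 / \<rho> * q y" if y: "y \<notin> (\<Union>x\<in>F. ball x (\<delta> x))" for y
  proof -
    have "\<rho> \<le> infdist y U"
      unfolding infdist_notempty[OF \<open>U \<noteq> {}\<close>]
    proof (rule cINF_greatest)
      fix a assume "a \<in> U"
      then obtain x where x: "x \<in> F" "dist x a < \<delta> x / 2" by (auto simp: U_def)
      have "\<delta> x \<le> dist x y" using y x(1) by force
      moreover have "dist x y \<le> dist x a + dist y a" by (rule dist_triangle2)
      ultimately show "\<rho> \<le> dist y a" using x(2) \<rho>_le[OF x(1)] by linarith
    qed fact
    then have "q y = \<rho>" by (simp add: q_def)
    then show ?thesis using \<rho> by simp
  qed
  have "1 / \<rho> * (\<integral>\<omega>. q (Y \<omega>) \<partial>N) = (\<integral>\<omega>. 1 / \<rho> * q (Y \<omega>) \<partial>N)" by simp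
  also have "\<dots> \<le> (\<integral>\<omega>. indicator {\<omega> \<in> space N. Y \<omega> \<notin> U} \<omega> \<partial>N)"
  proof (rule integral_mono)
    show "integrable N (\<lambda>\<omega>. 1 / \<rho> * q (Y \<omega>))" using BL1_integrable[OF q Y] by simp
    have [measurable]: "U \<in> sets borel" unfolding U_def by (intro borel_open open_UN) auto
    have "{\<omega> \<in> space N. Y \<omega> \<notin> U} \<in> sets N" by measurable
    then show "integrable N (indicat_real {\<omega> \<in> space N. Y \<omega> \<notin> U})"
      by (auto simp: emeasure_eq_measure)
    fix \<omega> assume "\<omega> \<in> space N"
    then show "1 / \<rho> * q (Y \<omega>) \<le> indicator {\<omega> \<in> space N. Y \<omega> \<notin> U} \<omega>"
      using q01(2)[of "Y \<omega>"] \<rho> by (cases "Y \<omega> \<in> U") (auto simp: q_def field_simps)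
  qed
  also have "\<dots> = measure N {\<omega> \<in> space N. Y \<omega> \<notin> U}" by (simp add: Int_absorb2 Collect_conj_eq)
  also have "\<dots> \<le> \<eta>" using F(4) by (simp add: U_def Int_absorb2)
  finally have "1 / \<rho> * (\<integral>\<omega>. q (Y \<omega>) \<partial>N) \<le> \<eta>" .
  with F(1-3) q q01(1) out \<rho>(1) show thesis by (intro that[of F q "1 / \<rho>"]) auto
qed

text \<open>The quantifier order matters: \<open>K\<close>, \<open>c\<close>,
  \<open>\<delta>\<close> and \<open>q\<close> are fixed before \<open>h\<close>, as the supremum
  over \<open>BL1\<close> demands. The comparison uses an extension \<open>g\<close> because the
  directions \<open>y\<close> may lie outside \<open>D0\<close>.\<close>

lemma uniformly_hadamard_BL1_approximation:
  fixes \<phi> \<phi>' :: "'d::real_normed_vector \<Rightarrow> 'e::real_normed_vector"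
  assumes "prob_space N" and sep: "separable_random_element N Y"
    and D0: "\<And>\<omega>. \<omega> \<in> space N \<Longrightarrow> Y \<omega> \<in> D0"
    and uhd: "uniformly_hadamard_derivative \<phi> D\<phi> P D0 \<phi>'" and "\<epsilon> > 0"
  obtains K c \<delta> q where "K > 0" "c > 0" "\<delta> > 0" "q \<in> BL1" "\<forall>y. 0 \<le> q y"
    "c * (\<integral>\<omega>. q (Y \<omega>) \<partial>N) \<le> \<epsilon>"
    "\<forall>h\<in>BL1. \<exists>g\<in>BL1. (\<forall>x\<in>D0. h (\<phi>' x) = K * g x) \<and>
       (\<forall>t \<theta> y. t \<noteq> 0 \<and> \<bar>t\<bar> < \<delta> \<and> dist \<theta> P < \<delta> \<and> \<theta> \<in> D\<phi> \<and> \<theta> + t *\<^sub>R y \<in> D\<phi> \<longrightarrow>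
          \<bar>h (inverse t *\<^sub>R (\<phi> (\<theta> + t *\<^sub>R y) - \<phi> \<theta>)) - K * g y\<bar> \<le> \<epsilon> + c * q y)"
proof -
  have D0sub: "subspace D0" using uhd by (simp add: uniformly_hadamard_derivative_def)
  then have "0 \<in> D0" by (rule subspace_0)
  obtain K where K: "K \<ge> 1" "K-lipschitz_on D0 \<phi>'"
    by (rule linear_on_subspace_imp_lipschitz[of D0 \<phi>'])
      (use uhd in \<open>auto simp: uniformly_hadamard_derivative_def\<close>)
  \<comment> \<open>The error is split in two halves: one for the difference quotient against
    \<open>\<phi>' x\<close>, the other for the variation of a \<open>K\<close>-Lipschitz function
    over the ball, hence the cap \<open>\<epsilon> / (2 * K)\<close> on the radius.\<close>
  have "\<exists>\<delta>>0. \<delta> \<le> \<epsilon> / (2 * K) \<and> (\<forall>t \<theta> h. t \<noteq> 0 \<and> \<bar>t\<bar> < \<delta> \<and> dist \<theta> P < \<delta> \<and> dist h x < \<delta> \<and> \<theta> \<in> D\<phi> \<and> \<theta> + t *\<^sub>R h \<in> D\<phi> \<longrightarrow>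
      dist (inverse t *\<^sub>R (\<phi> (\<theta> + t *\<^sub>R h) - \<phi> \<theta>)) (\<phi>' x) < \<epsilon> / 2)" if xD: "x \<in> D0" for x
  proof -
    obtain \<delta> where "\<delta> > 0" "\<And>t \<theta> h. \<lbrakk>t \<noteq> 0; \<bar>t\<bar> < \<delta>; dist \<theta> P < \<delta>; dist h x < \<delta>; \<theta> \<in> D\<phi>; \<theta> + t *\<^sub>R h \<in> D\<phi>\<rbrakk> \<Longrightarrow>
      dist (inverse t *\<^sub>R (\<phi> (\<theta> + t *\<^sub>R h) - \<phi> \<theta>)) (\<phi>' x) < \<epsilon> / 2"
      by (rule uniformly_hadamard_eps_delta[where \<epsilon> = "\<epsilon> / 2", OF uhd xD]) (use \<open>\<epsilon> > 0\<close> in auto)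
    then show ?thesis using \<open>\<epsilon> > 0\<close> K(1) by (intro exI[of _ "min \<delta> (\<epsilon> / (2 * K))"]) auto
  qed
  then obtain \<delta> where \<delta>: "\<And>x. x \<in> D0 \<Longrightarrow> \<delta> x > 0" "\<And>x. x \<in> D0 \<Longrightarrow> \<delta> x \<le> \<epsilon> / (2 * K)"
    "\<And>x t \<theta> h. x \<in> D0 \<Longrightarrow> t \<noteq> 0 \<and> \<bar>t\<bar> < \<delta> x \<and> dist \<theta> P < \<delta> x \<and> dist h x < \<delta> x \<and> \<theta> \<in> D\<phi> \<and> \<theta> + t *\<^sub>R h \<in> D\<phi> \<Longrightarrow>
      dist (inverse t *\<^sub>R (\<phi> (\<theta> + t *\<^sub>R h) - \<phi> \<theta>)) (\<phi>' x) < \<epsilon> / 2"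
    by metis
  obtain F q c where F: "finite F" "F \<noteq> {}" "F \<subseteq> D0" and q: "q \<in> BL1" "c > 0" "\<And>y. 0 \<le> q y"
    "\<And>y. y \<notin> (\<Union>x\<in>F. ball x (\<delta> x)) \<Longrightarrow> 1 \<le> c * q y"
    "c * (\<integral>\<omega>. q (Y \<omega>) \<partial>N) \<le> \<epsilon> / 2"
    by (rule separable_random_element_BL1_cutoff[where \<eta> = "\<epsilon> / 2", OF assms(1) sep D0 \<delta>(1)])
      (use \<open>\<epsilon> > 0\<close> in auto)
  define \<delta>' where "\<delta>' = Min (\<delta> ` F)"
  have \<delta>': "\<delta>' > 0" "\<And>x. x \<in> F \<Longrightarrow> \<delta>' \<le> \<delta> x"
    using F \<delta>(1) by (auto simp: \<delta>'_def)
  \<comment> \<open>Off the balls two functions bounded by 1 differ by at most 2, which costs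
    \<open>2 * c * q y\<close>. The cutoff was therefore requested with
    \<open>\<epsilon> / 2\<close>, so that doubling \<open>c\<close> still leaves expectation at
    most \<open>\<epsilon>\<close>.\<close>
  have approx: "\<exists>g\<in>BL1. (\<forall>x\<in>D0. h (\<phi>' x) = K * g x) \<and>
       (\<forall>t \<theta> y. t \<noteq> 0 \<and> \<bar>t\<bar> < \<delta>' \<and> dist \<theta> P < \<delta>' \<and> \<theta> \<in> D\<phi> \<and> \<theta> + t *\<^sub>R y \<in> D\<phi> \<longrightarrow>
          \<bar>h (inverse t *\<^sub>R (\<phi> (\<theta> + t *\<^sub>R y) - \<phi> \<theta>)) - K * g y\<bar> \<le> \<epsilon> + 2 * c * q y)"
    if h: "h \<in> BL1" for h
  proof -
    have hlip: "\<bar>h a - h b\<bar> \<le> dist a b" and h1: "\<bar>h a\<bar> \<le> 1" for a b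
      using h lipschitz_onD[of 1 UNIV h a b] by (auto simp: BL1_def dist_real_def)
    have "K-lipschitz_on D0 (\<lambda>x. h (\<phi>' x))"
    proof (rule lipschitz_onI)
      fix x y assume "x \<in> D0" "y \<in> D0"
      with hlip[of "\<phi>' x" "\<phi>' y"] lipschitz_onD[OF K(2)]
      show "dist (h (\<phi>' x)) (h (\<phi>' y)) \<le> K * dist x y" by (force simp: dist_real_def)
    qed (use K in auto)
    then obtain f where f: "K-lipschitz_on UNIV f" "\<And>x. \<bar>f x\<bar> \<le> 1" "\<And>x. x \<in> D0 \<Longrightarrow> f x = h (\<phi>' x)"
      by (rule lipschitz_extension_bounded[of K D0 _ 1]) (use h1 \<open>0 \<in> D0\<close> in auto)
    have flip: "\<bar>f x - f y\<bar> \<le> K * dist x y" for x y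
      using lipschitz_onD[OF f(1), of x y] by (simp add: dist_real_def)
    \<comment> \<open>Division by \<open>K\<close> normalises the Lipschitz constant to 1, and
      \<open>K \<ge> 1\<close> preserves the bound by 1.\<close>
    have "(\<lambda>x. f x / K) \<in> BL1"
      unfolding BL1_def
    proof (intro CollectI conjI allI lipschitz_onI)
      fix x y
      show "\<bar>f x / K\<bar> \<le> 1" using f(2)[of x] K(1) by (simp add: abs_divide divide_le_eq)
      have "\<bar>f x / K - f y / K\<bar> = \<bar>f x - f y\<bar> / K" using K(1) by (simp add: diff_divide_distrib[symmetric])
      then show "dist (f x / K) (f y / K) \<le> 1 * dist x y"
        using flip[of x y] K(1) by (simp add: dist_real_def divide_le_eq mult.commute)
    qed auto
    moreover have "\<forall>x\<in>D0. h (\<phi>' x) = K * (f x / K)" using K(1) f(3) by simp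
    moreover have "\<bar>h (inverse t *\<^sub>R (\<phi> (\<theta> + t *\<^sub>R y) - \<phi> \<theta>)) - K * (f y / K)\<bar> \<le> \<epsilon> + 2 * c * q y"
      if t: "t \<noteq> 0 \<and> \<bar>t\<bar> < \<delta>' \<and> dist \<theta> P < \<delta>' \<and> \<theta> \<in> D\<phi> \<and> \<theta> + t *\<^sub>R y \<in> D\<phi>" for t \<theta> y
    proof -
      let ?z = "inverse t *\<^sub>R (\<phi> (\<theta> + t *\<^sub>R y) - \<phi> \<theta>)"
      have "\<bar>h ?z - f y\<bar> \<le> \<epsilon> + 2 * c * q y"
      proof (cases "y \<in> (\<Union>x\<in>F. ball x (\<delta> x))")
        case True
        then obtain x where x: "x \<in> F" "dist y x < \<delta> x" by (auto simp: dist_commute)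
        then have xD: "x \<in> D0" using F(3) by auto
        have "\<bar>t\<bar> < \<delta> x" "dist \<theta> P < \<delta> x" using t \<delta>'(2)[OF x(1)] by auto
        then have "dist ?z (\<phi>' x) < \<epsilon> / 2" using t x by (intro \<delta>(3)[OF xD]) auto
        then have "\<bar>h ?z - f x\<bar> < \<epsilon> / 2" using hlip[of ?z "\<phi>' x"] f(3)[OF xD] by simp
        moreover have "\<bar>f x - f y\<bar> \<le> \<epsilon> / 2"
        proof -
          have "\<bar>f x - f y\<bar> \<le> K * dist x y" by (rule flip)
          also have "\<dots> \<le> K * (\<epsilon> / (2 * K))"
            using x(2) \<delta>(2)[OF xD] K(1) by (intro mult_left_mono) (auto simp: dist_commute)
          finally show ?thesis using K(1) by simp
        qed
        moreover have "0 \<le> 2 * c * q y" using q(2,3) by simp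
        ultimately show ?thesis by linarith
      next
        case False
        have "\<bar>h ?z - f y\<bar> \<le> 2" using h1[of ?z] f(2)[of y] by linarith
        then show ?thesis using q(4)[OF False] \<open>\<epsilon> > 0\<close> by (simp add: mult.assoc)
      qed
      then show ?thesis using K(1) by simp
    qed
    ultimately show ?thesis by (intro bexI[of _ "\<lambda>x. f x / K"]) blast
  qed
  show thesis
    by (rule that[of K "2 * c" \<delta>' q]) (use K(1) q \<delta>' approx in \<open>auto simp: mult.assoc\<close>)
qed

section \<open>Conditional weak convergence\<close>

lemma zero_in_BL1: "(\<lambda>_. 0) \<in> BL1"
  by (auto simp: BL1_def lipschitz_on_def)

text \<open>Boundedness is what lets the real supremum dominate each of its members.\<close>

lemma BL1_discrepancy_bdd_above:
  fixes y :: "'b \<Rightarrow> 's::metric_space"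
  assumes "prob_space Q" "prob_space N" "Y \<in> borel_measurable N"
  shows "bdd_above ((\<lambda>h. \<bar>(\<integral>\<omega>2. measurable_majorant Q (\<lambda>\<omega>. h (y \<omega>)) \<omega>2 \<partial>Q) - (\<integral>\<omega>. h (Y \<omega>) \<partial>N)\<bar>) ` BL1)"
proof (rule bdd_aboveI2)
  fix h :: "'s \<Rightarrow> real" assume h: "h \<in> BL1"
  have "\<bar>\<integral>\<omega>2. measurable_majorant Q (\<lambda>\<omega>. h (y \<omega>)) \<omega>2 \<partial>Q\<bar> \<le> 1"
    by (rule prob_space.abs_integral_majorant_le[OF assms(1)]) (use h in \<open>auto simp: BL1_def\<close>)
  moreover have "\<bar>\<integral>\<omega>. h (Y \<omega>) \<partial>N\<bar> \<le> 1"
    by (rule prob_space.BL1_expectation_bound[OF assms(2) h assms(3)])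
  ultimately show "\<bar>(\<integral>\<omega>2. measurable_majorant Q (\<lambda>\<omega>. h (y \<omega>)) \<omega>2 \<partial>Q) - (\<integral>\<omega>. h (Y \<omega>) \<partial>N)\<bar> \<le> 2"
    by linarith
qed

text \<open>This isolates the measure-theoretic part: \<open>z\<close> enters only through its
  comparison with \<open>y\<close>, and \<open>B n\<close> absorbs the first coordinates where that
  comparison fails. Majorants are compared section by section for the first condition and jointly
  for the second.\<close>

lemma cond_weakly_converges_transfer:
  fixes y :: "nat \<Rightarrow> 'a \<times> 'b \<Rightarrow> 'd::metric_space" and z :: "nat \<Rightarrow> 'a \<times> 'b \<Rightarrow> 'e::metric_space"
  assumes "prob_space Q1" "prob_space Q2" "prob_space N"
    and cw: "cond_weakly_converges Q1 Q2 y N Y" and sepW: "separable_random_element N W"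
    and approx: "\<And>\<epsilon>. \<epsilon> > 0 \<Longrightarrow> \<exists>K c q B n0. K > 0 \<and> c > 0 \<and> q \<in> BL1 \<and> (\<forall>x. 0 \<le> q x) \<and>
        c * (\<integral>\<omega>. q (Y \<omega>) \<partial>N) \<le> \<epsilon> \<and> outer_null Q1 B \<and>
        (\<forall>h\<in>BL1. \<exists>g\<in>BL1. (\<integral>\<omega>. h (W \<omega>) \<partial>N) = K * (\<integral>\<omega>. g (Y \<omega>) \<partial>N) \<and>
          (\<forall>n\<ge>n0. \<forall>\<omega>1\<in>space Q1 - B n. \<forall>\<omega>2\<in>space Q2.
             \<bar>h (z n (\<omega>1, \<omega>2)) - K * g (y n (\<omega>1, \<omega>2))\<bar> \<le> \<epsilon> + c * q (y n (\<omega>1, \<omega>2))))"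
  shows "cond_weakly_converges Q1 Q2 z N W"
proof -
  interpret Q1: prob_space Q1 by fact
  interpret Q2: prob_space Q2 by fact
  interpret N: prob_space N by fact
  interpret Q: pair_prob_space Q1 Q2 by standard
  have Y[measurable]: "Y \<in> borel_measurable N" and W[measurable]: "W \<in> borel_measurable N"
    using cw sepW by (auto simp: cond_weakly_converges_def separable_random_element_def)
  let ?Q = "Q1 \<Otimes>\<^sub>M Q2"
  define Sy where "Sy n \<omega>1 = (SUP h\<in>BL1.
    \<bar>(\<integral>\<omega>2. measurable_majorant Q2 (\<lambda>\<omega>. h (y n (\<omega>1, \<omega>))) \<omega>2 \<partial>Q2) - (\<integral>\<omega>. h (Y \<omega>) \<partial>N)\<bar>)" for n \<omega>1
  define Sz where "Sz n \<omega>1 = (SUP h\<in>BL1.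
    \<bar>(\<integral>\<omega>2. measurable_majorant Q2 (\<lambda>\<omega>. h (z n (\<omega>1, \<omega>))) \<omega>2 \<partial>Q2) - (\<integral>\<omega>. h (W \<omega>) \<partial>N)\<bar>)" for n \<omega>1
  define Gap where "Gap T \<omega>1 = (\<integral>\<omega>2. measurable_majorant ?Q T (\<omega>1, \<omega>2) \<partial>Q2) -
    (\<integral>\<omega>2. measurable_minorant ?Q T (\<omega>1, \<omega>2) \<partial>Q2)" for T \<omega>1
  have Sy_null: "outer_null Q1 (\<lambda>n. {\<omega> \<in> space Q1. \<bar>Sy n \<omega>\<bar> > d})" if "d > 0" for d
    using cw that unfolding cond_weakly_converges_def tendsto_0_outer_prob_iff Sy_def by blast
  have Gap_null: "outer_null Q1 (\<lambda>n. {\<omega> \<in> space Q1. \<bar>Gap (\<lambda>\<omega>. h (y n \<omega>)) \<omega>\<bar> > d})" if "d > 0" "h \<in> BL1" for d h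
    using cw that unfolding cond_weakly_converges_def tendsto_0_outer_prob_iff Gap_def by blast
  have Sy_upper: "\<bar>(\<integral>\<omega>2. measurable_majorant Q2 (\<lambda>\<omega>. h (y n (\<omega>1, \<omega>))) \<omega>2 \<partial>Q2) - (\<integral>\<omega>. h (Y \<omega>) \<partial>N)\<bar> \<le> \<bar>Sy n \<omega>1\<bar>"
    if "h \<in> BL1" for h n \<omega>1
  proof -
    have "\<bar>(\<integral>\<omega>2. measurable_majorant Q2 (\<lambda>\<omega>. h (y n (\<omega>1, \<omega>))) \<omega>2 \<partial>Q2) - (\<integral>\<omega>. h (Y \<omega>) \<partial>N)\<bar> \<le> Sy n \<omega>1"
      unfolding Sy_def by (rule cSUP_upper[OF that BL1_discrepancy_bdd_above[OF assms(2,3) Y]])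
    then show ?thesis by linarith
  qed
  have BL1_le1: "\<bar>h x\<bar> \<le> 1" if "h \<in> BL1" for h :: "'s::metric_space \<Rightarrow> real" and x
    using that by (simp add: BL1_def)

  have "tendsto_0_outer_prob Q1 Sz"
  proof (rule tendsto_0_outer_probI)
    fix e :: real assume "e > 0"
    then obtain K c q B n0 where K: "K > 0" "c > 0" and q: "q \<in> BL1" "\<And>x. 0 \<le> q x"
      "c * (\<integral>\<omega>. q (Y \<omega>) \<partial>N) \<le> e / 4" and B: "outer_null Q1 B" and
      app: "\<And>h. h \<in> BL1 \<Longrightarrow> \<exists>g\<in>BL1. (\<integral>\<omega>. h (W \<omega>) \<partial>N) = K * (\<integral>\<omega>. g (Y \<omega>) \<partial>N) \<and>
          (\<forall>n\<ge>n0. \<forall>\<omega>1\<in>space Q1 - B n. \<forall>\<omega>2\<in>space Q2.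
             \<bar>h (z n (\<omega>1, \<omega>2)) - K * g (y n (\<omega>1, \<omega>2))\<bar> \<le> e / 4 + c * q (y n (\<omega>1, \<omega>2)))"
      using approx[of "e / 4"] by (auto, blast)
    \<comment> \<open>The budget is \<open>e / 4\<close> for the approximation, \<open>e / 4\<close>
      for the expectation of \<open>c * q\<close>, and \<open>K * d + c * d = e / 2\<close> for
      replacing the laws of \<open>g\<close> and \<open>q\<close> under \<open>y\<close> by those
      under \<open>Y\<close>.\<close>
    define d where "d = e / 2 / (K + c)"
    have "K + c \<noteq> 0" using K by simp
    then have "(K + c) * d = e / 2" unfolding d_def by (metis nonzero_mult_div_cancel_left times_divide_eq_right)
    then have d2: "K * d + c * d = e / 2"
      by (simp add: distrib_right)
    have d1: "d > 0" using \<open>e > 0\<close> K by (simp add: d_def)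
    define A where "A n = B n \<union> {\<omega> \<in> space Q1. \<bar>Sy n \<omega>\<bar> > d}" for n
    have "\<bar>Sz n \<omega>1\<bar> \<le> e" if n: "n \<ge> n0" and \<omega>1: "\<omega>1 \<in> space Q1" "\<omega>1 \<notin> A n" for n \<omega>1
    proof -
      define I where "I T = (\<integral>\<omega>2. measurable_majorant Q2 T \<omega>2 \<partial>Q2)" for T
      have bound: "\<bar>I (\<lambda>\<omega>. h (z n (\<omega>1, \<omega>))) - (\<integral>\<omega>. h (W \<omega>) \<partial>N)\<bar> \<le> e" if h: "h \<in> BL1" for h
      proof -
        obtain g where g: "g \<in> BL1" "(\<integral>\<omega>. h (W \<omega>) \<partial>N) = K * (\<integral>\<omega>. g (Y \<omega>) \<partial>N)" and
          near: "\<And>\<omega>2. \<omega>2 \<in> space Q2 \<Longrightarrow>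
             \<bar>h (z n (\<omega>1, \<omega>2)) - K * g (y n (\<omega>1, \<omega>2))\<bar> \<le> e / 4 + c * q (y n (\<omega>1, \<omega>2))"
          using app[OF h] n \<omega>1 unfolding A_def by blast
        let ?h = "\<lambda>\<omega>. h (z n (\<omega>1, \<omega>))" and ?g = "\<lambda>\<omega>. g (y n (\<omega>1, \<omega>))" and ?q = "\<lambda>\<omega>. q (y n (\<omega>1, \<omega>))"
        have "I ?h \<le> e / 4 + K * I ?g + c * I ?q"
          unfolding I_def
        proof (rule Q2.integral_majorant_combination[where C = 1 and ?C1.0 = 1 and ?C2.0 = 1])
          fix \<omega> assume "\<omega> \<in> space Q2"
          from near[OF this] show "?h \<omega> \<le> e / 4 + K * ?g \<omega> + c * ?q \<omega>" by linarith
        qed (use BL1_le1[OF h] BL1_le1[OF g(1)] BL1_le1[OF q(1)] K in auto)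
        \<comment> \<open>The lower bound for \<open>I ?h\<close> comes from bounding
          \<open>I ?g\<close> above by it, since majorants are subadditive only for nonnegative
          coefficients.\<close>
        moreover have "I ?g \<le> e / 4 / K + 1 / K * I ?h + c / K * I ?q"
          unfolding I_def
        proof (rule Q2.integral_majorant_combination[where C = 1 and ?C1.0 = 1 and ?C2.0 = 1])
          fix \<omega> assume "\<omega> \<in> space Q2"
          from near[OF this] have "K * ?g \<omega> \<le> e / 4 + ?h \<omega> + c * ?q \<omega>" by linarith
          then have "?g \<omega> \<le> (e / 4 + ?h \<omega> + c * ?q \<omega>) / K"
            using K by (simp add: pos_le_divide_eq mult.commute)
          then show "?g \<omega> \<le> e / 4 / K + 1 / K * ?h \<omega> + c / K * ?q \<omega>" by (simp add: add_divide_distrib)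
        qed (use BL1_le1[OF h] BL1_le1[OF g(1)] BL1_le1[OF q(1)] K in auto)
        then have "K * I ?g \<le> e / 4 + I ?h + c * I ?q" using K by (simp add: field_simps)
        moreover have Sd: "\<bar>Sy n \<omega>1\<bar> \<le> d" using \<omega>1 by (auto simp: A_def)
        have "\<bar>I ?g - (\<integral>\<omega>. g (Y \<omega>) \<partial>N)\<bar> \<le> d"
          using Sy_upper[OF g(1), of n \<omega>1] Sd unfolding I_def by linarith
        then have "K * \<bar>I ?g - (\<integral>\<omega>. g (Y \<omega>) \<partial>N)\<bar> \<le> K * d" using K by (intro mult_left_mono) auto
        then have "\<bar>K * I ?g - K * (\<integral>\<omega>. g (Y \<omega>) \<partial>N)\<bar> \<le> K * d"
          using K by (simp add: abs_mult right_diff_distrib[symmetric])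
        moreover have "I ?q \<le> (\<integral>\<omega>. q (Y \<omega>) \<partial>N) + d"
          using Sy_upper[OF q(1), of n \<omega>1] Sd unfolding I_def by linarith
        then have "c * I ?q \<le> c * ((\<integral>\<omega>. q (Y \<omega>) \<partial>N) + d)" using K by (intro mult_left_mono) auto
        then have "c * I ?q \<le> c * (\<integral>\<omega>. q (Y \<omega>) \<partial>N) + c * d" by (simp add: distrib_left)
        ultimately show ?thesis using d2 q(3) g(2) by linarith
      qed
      have "Sz n \<omega>1 \<le> e"
        unfolding Sz_def by (rule cSUP_least) (use zero_in_BL1 bound in \<open>auto simp: I_def\<close>)
      moreover have "0 \<le> Sz n \<omega>1"
        unfolding Sz_def
        by (rule cSUP_upper2[OF BL1_discrepancy_bdd_above[OF assms(2,3) W] zero_in_BL1]) simp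
      ultimately show ?thesis by simp
    qed
    then have "\<forall>\<^sub>F n in sequentially. AE \<omega>1 in Q1. \<omega>1 \<notin> A n \<longrightarrow> \<bar>Sz n \<omega>1\<bar> \<le> e"
      unfolding eventually_sequentially by (intro exI[of _ n0] allI impI AE_I2) auto
    moreover have "outer_null Q1 A"
      unfolding A_def by (intro outer_null_Un B Sy_null d1)
    ultimately show "\<exists>A. outer_null Q1 A \<and> (\<forall>\<^sub>F n in sequentially. AE \<omega>1 in Q1. \<omega>1 \<notin> A n \<longrightarrow> \<bar>Sz n \<omega>1\<bar> \<le> e)"
      by blast
  qed
  moreover have "tendsto_0_outer_prob Q1 (\<lambda>n. Gap (\<lambda>\<omega>. h (z n \<omega>)))" if h: "h \<in> BL1" for h
  proof (rule tendsto_0_outer_probI)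
    fix e :: real assume "e > 0"
    then obtain K c q B n0 where K: "K > 0" "c > 0" and q: "q \<in> BL1" "\<And>x. 0 \<le> q x"
      "c * (\<integral>\<omega>. q (Y \<omega>) \<partial>N) \<le> e / 8" and B: "outer_null Q1 B" and
      app: "\<And>h. h \<in> BL1 \<Longrightarrow> \<exists>g\<in>BL1. (\<integral>\<omega>. h (W \<omega>) \<partial>N) = K * (\<integral>\<omega>. g (Y \<omega>) \<partial>N) \<and>
          (\<forall>n\<ge>n0. \<forall>\<omega>1\<in>space Q1 - B n. \<forall>\<omega>2\<in>space Q2.
             \<bar>h (z n (\<omega>1, \<omega>2)) - K * g (y n (\<omega>1, \<omega>2))\<bar> \<le> e / 8 + c * q (y n (\<omega>1, \<omega>2)))"
      using approx[of "e / 8"] by (auto, blast)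
    obtain g where g: "g \<in> BL1" and
      near: "\<And>n \<omega>1 \<omega>2. n \<ge> n0 \<Longrightarrow> \<omega>1 \<in> space Q1 \<Longrightarrow> \<omega>1 \<notin> B n \<Longrightarrow> \<omega>2 \<in> space Q2 \<Longrightarrow>
             \<bar>h (z n (\<omega>1, \<omega>2)) - K * g (y n (\<omega>1, \<omega>2))\<bar> \<le> e / 8 + c * q (y n (\<omega>1, \<omega>2))"
      using app[OF h] by blast
    \<comment> \<open>\<open>B n\<close> need not be measurable, but the bounds on the joint majorants have to be.\<close>
    obtain C where C[measurable]: "\<And>n. C n \<in> sets Q1" and BC: "\<And>n. B n \<subseteq> C n" and "outer_null Q1 C"
      using outer_null_measurable_cover[OF B] by blast
    \<comment> \<open>The gap of \<open>h\<close> is at most \<open>e / 4\<close> plus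
      \<open>K\<close> times the gap of \<open>g\<close> plus \<open>2 * c\<close> times the
      integral of the majorant of \<open>q\<close>. That integral exceeds the expectation of
      \<open>q\<close> by at most \<open>2 * d\<close>, which explains the factor 4.\<close>
    define d where "d = e / 2 / (K + 4 * c)"
    have "K + 4 * c \<noteq> 0" using K by simp
    then have "(K + 4 * c) * d = e / 2" unfolding d_def by (metis nonzero_mult_div_cancel_left times_divide_eq_right)
    then have d2: "K * d + 4 * (c * d) = e / 2"
      by (simp add: distrib_right)
    have d1: "d > 0" using \<open>e > 0\<close> K by (simp add: d_def)
    define A where "A n = C n \<union> {\<omega> \<in> space Q1. \<bar>Sy n \<omega>\<bar> > d} \<union>
      {\<omega> \<in> space Q1. \<bar>Gap (\<lambda>\<omega>. g (y n \<omega>)) \<omega>\<bar> > d} \<union> {\<omega> \<in> space Q1. \<bar>Gap (\<lambda>\<omega>. q (y n \<omega>)) \<omega>\<bar> > d}" for n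
    have "AE \<omega>1 in Q1. \<omega>1 \<notin> A n \<longrightarrow> \<bar>Gap (\<lambda>\<omega>. h (z n \<omega>)) \<omega>1\<bar> \<le> e" if n: "n \<ge> n0" for n
    proof -
      define U where "U T = measurable_majorant ?Q T" for T
      define L where "L T = measurable_minorant ?Q T" for T
      have maj: "is_majorant ?Q (\<lambda>\<omega>. f (v \<omega>)) (U (\<lambda>\<omega>. f (v \<omega>)))"
        if "f \<in> BL1" for f :: "'s::metric_space \<Rightarrow> real" and v
        unfolding U_def by (rule Q.P.is_majorant_measurable_majorant) (rule BL1_le1[OF that])
      have min: "is_majorant ?Q (\<lambda>\<omega>. - f (v \<omega>)) (\<lambda>\<omega>. - L (\<lambda>\<omega>. f (v \<omega>)) \<omega>)"
        if "f \<in> BL1" for f :: "'s::metric_space \<Rightarrow> real" and v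
        unfolding L_def by (rule Q.P.is_majorant_measurable_minorant) (rule BL1_le1[OF that])
      have meas: "U (\<lambda>\<omega>. f (v \<omega>)) \<in> borel_measurable ?Q" "L (\<lambda>\<omega>. f (v \<omega>)) \<in> borel_measurable ?Q"
        if "f \<in> BL1" for f :: "'s::metric_space \<Rightarrow> real" and v
        using maj[OF that, of v] min[OF that, of v] by (auto simp: is_majorant_def)
      have order: "L (\<lambda>\<omega>. f (v \<omega>)) \<omega> \<le> f (v \<omega>)" "f (v \<omega>) \<le> U (\<lambda>\<omega>. f (v \<omega>)) \<omega>"
        if "f \<in> BL1" "\<omega> \<in> space ?Q" for f :: "'s::metric_space \<Rightarrow> real" and v \<omega>
        using maj[OF that(1), of v] min[OF that(1), of v] that(2) by (auto simp: is_majorant_def)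
      \<comment> \<open>Joint majorants and minorants of bounded functions are integrable on the
        product, so by Fubini almost all their sections are integrable.\<close>
      have sect: "AE \<omega>1 in Q1. integrable Q2 (\<lambda>\<omega>2. U (\<lambda>\<omega>. f (v \<omega>)) (\<omega>1, \<omega>2)) \<and>
          integrable Q2 (\<lambda>\<omega>2. L (\<lambda>\<omega>. f (v \<omega>)) (\<omega>1, \<omega>2))"
        if "f \<in> BL1" for f :: "'s::metric_space \<Rightarrow> real" and v
      proof -
        have iU: "integrable ?Q (U (\<lambda>\<omega>. f (v \<omega>)))"
          by (rule Q.P.integrable_is_majorant[OF maj[OF that], where C = 1]) (use BL1_le1[OF that] in auto)
        have "integrable ?Q (\<lambda>\<omega>. - L (\<lambda>\<omega>. f (v \<omega>)) \<omega>)"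
          by (rule Q.P.integrable_is_majorant[OF min[OF that], where C = 1]) (use BL1_le1[OF that] in auto)
        then have iL: "integrable ?Q (L (\<lambda>\<omega>. f (v \<omega>)))" by simp
        show ?thesis
          by (rule eventually_conj[OF Q.AE_integrable_fst'[OF iU] Q.AE_integrable_fst'[OF iL]])
      qed
      let ?h = "\<lambda>\<omega>. h (z n \<omega>)" and ?g = "\<lambda>\<omega>. g (y n \<omega>)" and ?q = "\<lambda>\<omega>. q (y n \<omega>)"
      note [measurable] = meas[OF g, of "y n"] meas[OF q(1), of "y n"]
      \<comment> \<open>On \<open>C n\<close> the crude bound \<open>1 + K\<close> is used. The
        indicator makes the inequality valid on the whole product, as minimality of joint majorants
        requires, and vanishes on the sections considered later.\<close>
      have near': "\<bar>?h \<omega> - K * ?g \<omega>\<bar> \<le> e / 8 + c * ?q \<omega> + (1 + K) * indicat_real (C n) (fst \<omega>)"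
        if "\<omega> \<in> space ?Q" for \<omega>
      proof (cases "fst \<omega> \<in> C n")
        case True
        have "\<bar>K * ?g \<omega>\<bar> \<le> K" using BL1_le1[OF g, of "y n \<omega>"] K by (simp add: abs_mult)
        moreover have "0 \<le> c * ?q \<omega>" using K q(2) by simp
        ultimately show ?thesis using True BL1_le1[OF h, of "z n \<omega>"] \<open>e > 0\<close> by simp
      next
        case False
        moreover from this have "fst \<omega> \<notin> B n" using BC[of n] by blast
        ultimately show ?thesis
          using near[OF n, of "fst \<omega>" "snd \<omega>"] that by (auto simp: space_pair_measure)
      qed
      have ordK: "K * L ?g \<omega> \<le> K * ?g \<omega>" "K * ?g \<omega> \<le> K * U ?g \<omega>" "c * ?q \<omega> \<le> c * U ?q \<omega>"
        if "\<omega> \<in> space ?Q" for \<omega>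
        using order[OF g that, of "y n"] order[OF q(1) that, of "y n"] K by (auto intro: mult_left_mono)
      have up: "AE \<omega> in ?Q. U ?h \<omega> \<le> e / 8 + K * U ?g \<omega> + c * U ?q \<omega> + (1 + K) * indicat_real (C n) (fst \<omega>)"
      proof -
        have "AE \<omega> in ?Q. ?h \<omega> \<le> e / 8 + K * U ?g \<omega> + c * U ?q \<omega> + (1 + K) * indicat_real (C n) (fst \<omega>)"
        proof (rule AE_I2)
          fix \<omega> assume "\<omega> \<in> space ?Q"
          from near'[OF this] ordK[OF this]
          show "?h \<omega> \<le> e / 8 + K * U ?g \<omega> + c * U ?q \<omega> + (1 + K) * indicat_real (C n) (fst \<omega>)" by linarith
        qed
        moreover have "(\<lambda>\<omega>. e / 8 + K * U ?g \<omega> + c * U ?q \<omega> + (1 + K) * indicat_real (C n) (fst \<omega>)) \<in> borel_measurable ?Q"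
          by measurable
        ultimately show ?thesis by (rule is_majorant_le[OF maj[OF h, of "z n"]])
      qed
      \<comment> \<open>As \<open>- L ?h\<close> is a majorant of the negated function, minimality
        again turns a pointwise bound into an almost sure one.\<close>
      have low: "AE \<omega> in ?Q. - L ?h \<omega> \<le> e / 8 - K * L ?g \<omega> + c * U ?q \<omega> + (1 + K) * indicat_real (C n) (fst \<omega>)"
      proof -
        have "AE \<omega> in ?Q. - ?h \<omega> \<le> e / 8 - K * L ?g \<omega> + c * U ?q \<omega> + (1 + K) * indicat_real (C n) (fst \<omega>)"
        proof (rule AE_I2)
          fix \<omega> assume "\<omega> \<in> space ?Q"
          from near'[OF this] ordK[OF this]
          show "- ?h \<omega> \<le> e / 8 - K * L ?g \<omega> + c * U ?q \<omega> + (1 + K) * indicat_real (C n) (fst \<omega>)" by linarith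
        qed
        moreover have "(\<lambda>\<omega>. e / 8 - K * L ?g \<omega> + c * U ?q \<omega> + (1 + K) * indicat_real (C n) (fst \<omega>)) \<in> borel_measurable ?Q"
          by measurable
        ultimately show ?thesis by (rule is_majorant_le[OF min[OF h, of "z n"]])
      qed
      show ?thesis
        using Q.AE_pair[OF up] Q.AE_pair[OF low] sect[OF h, of "z n"] sect[OF g, of "y n"]
          sect[OF q(1), of "y n"] AE_space
      proof eventually_elim
        case (elim \<omega>1)
        have sp: "(\<omega>1, \<omega>2) \<in> space ?Q" if "\<omega>2 \<in> space Q2" for \<omega>2
          using that elim(6) by (simp add: space_pair_measure)
        define I where "I f = (\<integral>\<omega>2. f (\<omega>1, \<omega>2) \<partial>Q2)" for f :: "'a \<times> 'b \<Rightarrow> real"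
        have GapI: "Gap T \<omega>1 = I (U T) - I (L T)" for T
          by (simp add: Gap_def I_def U_def L_def)
        show ?case
        proof
          assume nA: "\<omega>1 \<notin> A n"
          then have nC: "\<omega>1 \<notin> C n" by (auto simp: A_def)
          have Sd: "\<bar>Sy n \<omega>1\<bar> \<le> d" "I (U ?g) - I (L ?g) \<le> d" "I (U ?q) - I (L ?q) \<le> d"
            using nA elim(6) by (auto simp: A_def GapI)
          have "I (L ?h) \<le> I (U ?h)"
            unfolding I_def using elim(3) order[OF h sp, of _ "z n"]
            by (intro integral_mono) (auto intro: order_trans)
          moreover have "I (U ?h) \<le> (\<integral>\<omega>2. e / 8 + K * U ?g (\<omega>1, \<omega>2) + c * U ?q (\<omega>1, \<omega>2) \<partial>Q2)"
            unfolding I_def using elim(1,3,4,5) nC by (intro integral_mono_AE) auto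
          then have "I (U ?h) \<le> e / 8 + K * I (U ?g) + c * I (U ?q)"
            using elim(4,5) by (simp add: I_def Q2.prob_space)
          moreover have "(\<integral>\<omega>2. - L ?h (\<omega>1, \<omega>2) \<partial>Q2) \<le>
              (\<integral>\<omega>2. e / 8 - K * L ?g (\<omega>1, \<omega>2) + c * U ?q (\<omega>1, \<omega>2) \<partial>Q2)"
            using elim(2,3,4,5) nC by (intro integral_mono_AE) auto
          then have "- I (L ?h) \<le> e / 8 - K * I (L ?g) + c * I (U ?q)"
            using elim(4,5) by (simp add: I_def Q2.prob_space)
          moreover have "K * (I (U ?g) - I (L ?g)) \<le> K * d" using Sd(2) K by (intro mult_left_mono) auto
          then have "K * I (U ?g) - K * I (L ?g) \<le> K * d" by (simp add: right_diff_distrib)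
          \<comment> \<open>Sections of the joint majorant of \<open>q\<close> may exceed the majorants of the sections, whereas
            sections of the joint minorant are below them; the gap of \<open>q\<close> closes the difference.\<close>
          moreover have "I (L ?q) \<le> (\<integral>\<omega>2. measurable_majorant Q2 (\<lambda>\<omega>. q (y n (\<omega>1, \<omega>))) \<omega>2 \<partial>Q2)"
            unfolding I_def
            by (rule Q2.integral_le_majorant[where C = 1])
              (use BL1_le1[OF q(1)] elim(5) order(1)[OF q(1) sp, of _ "y n"] in auto)
          then have "I (U ?q) \<le> (\<integral>\<omega>. q (Y \<omega>) \<partial>N) + 2 * d"
            using Sd(1,3) Sy_upper[OF q(1), of n \<omega>1] by linarith
          then have "c * I (U ?q) \<le> c * ((\<integral>\<omega>. q (Y \<omega>) \<partial>N) + 2 * d)" using K by (intro mult_left_mono) auto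
          then have "c * I (U ?q) \<le> c * (\<integral>\<omega>. q (Y \<omega>) \<partial>N) + 2 * (c * d)" by (simp add: algebra_simps)
          ultimately show "\<bar>Gap ?h \<omega>1\<bar> \<le> e" using d2 q(3) unfolding GapI by linarith
        qed
      qed
    qed
    then have "\<forall>\<^sub>F n in sequentially. AE \<omega>1 in Q1. \<omega>1 \<notin> A n \<longrightarrow> \<bar>Gap (\<lambda>\<omega>. h (z n \<omega>)) \<omega>1\<bar> \<le> e"
      by (auto simp: eventually_sequentially)
    moreover have "outer_null Q1 A"
      unfolding A_def by (intro outer_null_Un Sy_null Gap_null d1 g q(1)) fact
    ultimately show "\<exists>A. outer_null Q1 A \<and>
        (\<forall>\<^sub>F n in sequentially. AE \<omega>1 in Q1. \<omega>1 \<notin> A n \<longrightarrow> \<bar>Gap (\<lambda>\<omega>. h (z n \<omega>)) \<omega>1\<bar> \<le> e)"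
      by blast
  qed
  ultimately show ?thesis
    using sepW unfolding cond_weakly_converges_def Sz_def Gap_def by blast
qed

text \<open>Since \<open>f\<close> is continuous only on \<open>D\<close>, measurability goes
  through the restricted Borel space, and the separable carrier is the image of
  \<open>S \<inter> D\<close>.\<close>

lemma separable_random_element_continuous_image:
  fixes Y :: "'a \<Rightarrow> 'd::metric_space" and f :: "'d \<Rightarrow> 'e::metric_space"
  assumes sep: "separable_random_element N Y" and D: "\<And>\<omega>. \<omega> \<in> space N \<Longrightarrow> Y \<omega> \<in> D"
    and cont: "continuous_on D f"
  shows "separable_random_element N (\<lambda>\<omega>. f (Y \<omega>))"
proof -
  obtain S where Y: "Y \<in> borel_measurable N"
    and S: "separable_space (top_of_set S)" "AE \<omega> in N. Y \<omega> \<in> S"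
    using sep by (auto simp: separable_random_element_def)
  have "Y \<in> measurable N (restrict_space borel D)"
    using Y D by (intro measurable_restrict_space2) auto
  then have "(\<lambda>\<omega>. f (Y \<omega>)) \<in> borel_measurable N"
    by (rule measurable_compose[OF _ borel_measurable_continuous_on_restrict[OF cont]])
  moreover have "second_countable (top_of_set (S \<inter> D))"
    using second_countable_subtopology[OF separable_imp_second_countable[OF S(1)], of D]
    by (simp add: subtopology_subtopology)
  then have "separable_space (top_of_set (S \<inter> D))" by (rule second_countable_imp_separable_space)
  then have "separable_space (top_of_set (f ` (S \<inter> D)))"
    by (rule separable_space_continuous_map_image[where f = f])
      (use cont in \<open>auto intro: continuous_on_subset\<close>)
  moreover have "AE \<omega> in N. f (Y \<omega>) \<in> f ` (S \<inter> D)"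
    using S(2) AE_space by eventually_elim (use D in auto)
  ultimately show ?thesis unfolding separable_random_element_def by blast
qed

section \<open>The delta method for conditional laws\<close>

theorem theorem4:
  fixes Q1 :: "'a measure" and Q2 :: "'b measure"
    and \<chi>1 :: "nat \<Rightarrow> 'x set" and \<chi>2 :: "nat \<Rightarrow> 'm set"
    and X :: "nat \<Rightarrow> 'a \<Rightarrow> 'x" and M :: "nat \<Rightarrow> 'b \<Rightarrow> 'm"
    and \<phi> \<phi>' :: "'d::real_normed_vector \<Rightarrow> 'e::real_normed_vector"
    and D\<phi> D0 :: "'d set" and P :: 'd
    and r :: "nat \<Rightarrow> real" and Pn :: "nat \<Rightarrow> 'd"
    and Pemp :: "nat \<Rightarrow> 'x \<Rightarrow> 'd" and Phat :: "nat \<Rightarrow> 'x \<Rightarrow> 'm \<Rightarrow> 'd"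
    and G :: "'a \<Rightarrow> 'd" and Ghat :: "'a \<times> 'b \<Rightarrow> 'd"
  assumes "prob_space Q1" and "prob_space Q2"
    and "\<And>n. X n \<in> space Q1 \<rightarrow> \<chi>1 n" and "\<And>n. M n \<in> space Q2 \<rightarrow> \<chi>2 n"
    and "uniformly_hadamard_derivative \<phi> D\<phi> P D0 \<phi>'"
    and "filterlim r at_top sequentially"
    and "\<And>n. Pn n \<in> D\<phi>" and "Pn \<longlonglongrightarrow> P"
    and "\<And>n \<omega>1. \<omega>1 \<in> space Q1 \<Longrightarrow> Pemp n (X n \<omega>1) \<in> D\<phi>"
    and "separable_random_element Q1 G" and "\<And>\<omega>1. \<omega>1 \<in> space Q1 \<Longrightarrow> G \<omega>1 \<in> D0"
    and "weakly_converges (\<lambda>_. Q1) (\<lambda>n \<omega>1. r n *\<^sub>R (Pemp n (X n \<omega>1) - Pn n)) Q1 G"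
    and "\<And>n \<omega>1 \<omega>2. \<omega>1 \<in> space Q1 \<Longrightarrow> \<omega>2 \<in> space Q2 \<Longrightarrow> Phat n (X n \<omega>1) (M n \<omega>2) \<in> D\<phi>"
    and "separable_random_element (Q1 \<Otimes>\<^sub>M Q2) Ghat"
    and "\<And>\<omega>. \<omega> \<in> space (Q1 \<Otimes>\<^sub>M Q2) \<Longrightarrow> Ghat \<omega> \<in> D0"
    and "cond_weakly_converges Q1 Q2
           (\<lambda>n (\<omega>1, \<omega>2). r n *\<^sub>R (Phat n (X n \<omega>1) (M n \<omega>2) - Pemp n (X n \<omega>1)))
           (Q1 \<Otimes>\<^sub>M Q2) Ghat"
  shows "cond_weakly_converges Q1 Q2
           (\<lambda>n (\<omega>1, \<omega>2). r n *\<^sub>R (\<phi> (Phat n (X n \<omega>1) (M n \<omega>2)) - \<phi> (Pemp n (X n \<omega>1))))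
           (Q1 \<Otimes>\<^sub>M Q2) (\<lambda>\<omega>. \<phi>' (Ghat \<omega>))"
proof -
  let ?Q = "Q1 \<Otimes>\<^sub>M Q2"
  let ?y = "\<lambda>n (\<omega>1, \<omega>2). r n *\<^sub>R (Phat n (X n \<omega>1) (M n \<omega>2) - Pemp n (X n \<omega>1))"
  let ?z = "\<lambda>n (\<omega>1, \<omega>2). r n *\<^sub>R (\<phi> (Phat n (X n \<omega>1) (M n \<omega>2)) - \<phi> (Pemp n (X n \<omega>1)))"
  interpret Q1: prob_space Q1 by fact
  interpret Q2: prob_space Q2 by fact
  interpret Q: pair_prob_space Q1 Q2 by standard
  have probQ: "prob_space ?Q" by (rule Q.P.prob_space_axioms)
  note uhd = assms(5) and r = assms(6) and Pn = assms(8) and Pemp = assms(9) and wc = assms(12)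
    and Phat = assms(13) and sep = assms(14) and Ghat = assms(15) and cw = assms(16)
  show ?thesis
  proof (rule cond_weakly_converges_transfer[OF assms(1,2) probQ cw])
    show "separable_random_element ?Q (\<lambda>\<omega>. \<phi>' (Ghat \<omega>))"
      by (rule separable_random_element_continuous_image[OF sep Ghat])
        (use uhd in \<open>auto simp: uniformly_hadamard_derivative_def\<close>)
  next
    fix \<epsilon> :: real assume "\<epsilon> > 0"
    obtain K c \<delta> q where K: "K > 0" "c > 0" and \<delta>: "\<delta> > 0" and q: "q \<in> BL1" "\<forall>y. 0 \<le> q y"
      "c * (\<integral>\<omega>. q (Ghat \<omega>) \<partial>?Q) \<le> \<epsilon>" and
      approx: "\<forall>h\<in>BL1. \<exists>g\<in>BL1. (\<forall>x\<in>D0. h (\<phi>' x) = K * g x) \<and>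
        (\<forall>t \<theta> y. t \<noteq> 0 \<and> \<bar>t\<bar> < \<delta> \<and> dist \<theta> P < \<delta> \<and> \<theta> \<in> D\<phi> \<and> \<theta> + t *\<^sub>R y \<in> D\<phi> \<longrightarrow>
          \<bar>h (inverse t *\<^sub>R (\<phi> (\<theta> + t *\<^sub>R y) - \<phi> \<theta>)) - K * g y\<bar> \<le> \<epsilon> + c * q y)"
      by (rule uniformly_hadamard_BL1_approximation[OF probQ sep Ghat uhd \<open>\<epsilon> > 0\<close>])
    \<comment> \<open>Where \<open>r n > 0\<close>, these are the first coordinates at which
      \<open>Pemp\<close> is at distance at least \<open>\<delta> / 2\<close> from
      \<open>Pn n\<close>. Together with \<open>Pn n\<close> being within
      \<open>\<delta> / 2\<close> of \<open>P\<close>, their complements give base points within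
      \<open>\<delta>\<close> of \<open>P\<close>.\<close>
    define B where "B n = {\<omega>1 \<in> space Q1. r n * (\<delta> / 2) \<le> norm (r n *\<^sub>R (Pemp n (X n \<omega>1) - Pn n))}" for n
    have B: "outer_null Q1 B"
      unfolding B_def by (rule weakly_converges_scaled_null[OF assms(1) wc r]) (use \<delta> in simp)
    have "\<forall>\<^sub>F n in sequentially. 1 / \<delta> < r n \<and> dist (Pn n) P < \<delta> / 2"
      using r tendstoD[OF Pn, of "\<delta> / 2"] \<delta>
      by (intro eventually_conj) (auto simp: filterlim_at_top_dense)
    then obtain n0 where n0: "\<And>n. n \<ge> n0 \<Longrightarrow> 1 / \<delta> < r n" "\<And>n. n \<ge> n0 \<Longrightarrow> dist (Pn n) P < \<delta> / 2"
      by (auto simp: eventually_sequentially)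
    have "\<exists>g\<in>BL1. (\<integral>\<omega>. h (\<phi>' (Ghat \<omega>)) \<partial>?Q) = K * (\<integral>\<omega>. g (Ghat \<omega>) \<partial>?Q) \<and>
        (\<forall>n\<ge>n0. \<forall>\<omega>1\<in>space Q1 - B n. \<forall>\<omega>2\<in>space Q2.
          \<bar>h (?z n (\<omega>1, \<omega>2)) - K * g (?y n (\<omega>1, \<omega>2))\<bar> \<le> \<epsilon> + c * q (?y n (\<omega>1, \<omega>2)))"
      if h: "h \<in> BL1" for h
    proof -
      obtain g where g: "g \<in> BL1" "\<And>x. x \<in> D0 \<Longrightarrow> h (\<phi>' x) = K * g x" and
        near: "\<And>t \<theta> y. t \<noteq> 0 \<Longrightarrow> \<bar>t\<bar> < \<delta> \<Longrightarrow> dist \<theta> P < \<delta> \<Longrightarrow> \<theta> \<in> D\<phi> \<Longrightarrow> \<theta> + t *\<^sub>R y \<in> D\<phi> \<Longrightarrow>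
          \<bar>h (inverse t *\<^sub>R (\<phi> (\<theta> + t *\<^sub>R y) - \<phi> \<theta>)) - K * g y\<bar> \<le> \<epsilon> + c * q y"
        using bspec[OF approx h] by blast
      \<comment> \<open>\<open>Ghat\<close> takes its values in \<open>D0\<close>, where
        \<open>K * g\<close> extends \<open>h\<close> composed with \<open>\<phi>'\<close>
        exactly.\<close>
      have "(\<integral>\<omega>. h (\<phi>' (Ghat \<omega>)) \<partial>?Q) = (\<integral>\<omega>. K * g (Ghat \<omega>) \<partial>?Q)"
        by (rule Bochner_Integration.integral_cong) (use g(2) Ghat in auto)
      then have "(\<integral>\<omega>. h (\<phi>' (Ghat \<omega>)) \<partial>?Q) = K * (\<integral>\<omega>. g (Ghat \<omega>) \<partial>?Q)" by simp
      moreover have "\<bar>h (?z n (\<omega>1, \<omega>2)) - K * g (?y n (\<omega>1, \<omega>2))\<bar> \<le> \<epsilon> + c * q (?y n (\<omega>1, \<omega>2))"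
        if n: "n \<ge> n0" and \<omega>1: "\<omega>1 \<in> space Q1" "\<omega>1 \<notin> B n" and \<omega>2: "\<omega>2 \<in> space Q2" for n \<omega>1 \<omega>2
      proof -
        let ?\<theta> = "Pemp n (X n \<omega>1)" and ?\<theta>' = "Phat n (X n \<omega>1) (M n \<omega>2)"
        have "0 < 1 / \<delta>" using \<delta> by simp
        then have rn: "r n > 0" using n0(1)[OF n] by linarith
        have "1 < \<delta> * r n" using n0(1)[OF n] \<delta> by (simp add: pos_divide_less_eq mult.commute)
        then have small: "\<bar>inverse (r n)\<bar> < \<delta>"
          using n0(1)[OF n] rn \<delta> by (simp add: inverse_eq_divide pos_divide_less_eq mult.commute)
        have "r n * norm (?\<theta> - Pn n) < r n * (\<delta> / 2)" using \<omega>1 rn by (auto simp: B_def)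
        then have "dist ?\<theta> (Pn n) < \<delta> / 2" using rn by (simp add: dist_norm)
        then have "dist ?\<theta> P < \<delta>" using n0(2)[OF n] dist_triangle[of ?\<theta> P "Pn n"] by linarith
        \<comment> \<open>With step \<open>inverse (r n)\<close> the perturbed point is
          \<open>Phat\<close> itself, so the difference quotient is \<open>?z\<close> and its
          direction is \<open>?y\<close>.\<close>
        moreover have eq: "?\<theta> + inverse (r n) *\<^sub>R (r n *\<^sub>R (?\<theta>' - ?\<theta>)) = ?\<theta>'" using rn by simp
        ultimately show ?thesis
          using near[of "inverse (r n)" ?\<theta> "r n *\<^sub>R (?\<theta>' - ?\<theta>)"] small rn Pemp[OF \<omega>1(1)] Phat[OF \<omega>1(1) \<omega>2]
          unfolding eq by simp
      qed
      ultimately show ?thesis using g(1) by blast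
    qed
    with K q B show "\<exists>K c q B n0. K > 0 \<and> c > 0 \<and> q \<in> BL1 \<and> (\<forall>x. 0 \<le> q x) \<and>
        c * (\<integral>\<omega>. q (Ghat \<omega>) \<partial>?Q) \<le> \<epsilon> \<and> outer_null Q1 B \<and>
        (\<forall>h\<in>BL1. \<exists>g\<in>BL1. (\<integral>\<omega>. h (\<phi>' (Ghat \<omega>)) \<partial>?Q) = K * (\<integral>\<omega>. g (Ghat \<omega>) \<partial>?Q) \<and>
          (\<forall>n\<ge>n0. \<forall>\<omega>1\<in>space Q1 - B n. \<forall>\<omega>2\<in>space Q2.
             \<bar>h (?z n (\<omega>1, \<omega>2)) - K * g (?y n (\<omega>1, \<omega>2))\<bar> \<le> \<epsilon> + c * q (?y n (\<omega>1, \<omega>2))))"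
      by blast
  qed
qed

end
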